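(* Let $\mathbf{X}=(X_1,\ldots,X_N)^\intercal$ fulfill the assumptions listed in the context. For any $y(\mathbf{X})\in L^2(\Omega,\mathcal{F},\mathbb{P})$ and any fixed degree $\mathbf{p}\in\mathbb{N}_0^N$, a sequence of SCE approximations $\{y_{\mathbf{p},\boldsymbol{\Xi}}(\mathbf{X})\}_{\mathbf{h}>\mathbf{0}}$, with $\mathbf{h}=(h_1,\ldots,h_N)$ the vector of largest element sizes of $\boldsymbol{\Xi}$, converges to $y(\mathbf{X})$ in mean-square, that is, $$\lim_{\mathbf{h}\to\mathbf{0}}\mathbb{E}\left[|y(\mathbf{X})-y_{\mathbf{p},\boldsymbol{\Xi}}(\mathbf{X})|^2\right]=0.$$ Furthermore, the sequence converges in probability, that is, for any $\epsilon>0$, $$\lim_{\mathbf{h}\to\mathbf{0}}\mathbb{P}\left(|y(\mathbf{X})-y_{\mathbf{p},\boldsymbol{\Xi}}(\mathbf{X})|>\epsilon\right)=0;$$ and converges in distribution, that is, for all points $\xi\in\mathbb{R}$ where $F$ is continuous, $$\lim_{\mathbf{h}\to\mathbf{0}}F_{\mathbf{p},\boldsymbol{\Xi}}(\xi)=F(\xi),$$ where $F_{\mathbf{p},\boldsymbol{\Xi}}(\xi):=\mathbb{P}(y_{\mathbf{p},\boldsymbol{\Xi}}(\mathbf{X})\le\xi)$ and $F(\xi):=\mathbb{P}(y(\mathbf{X})\le\xi)$. If $F$ is continuous on $\mathbb{R}$, then the distribution functions converge uniformly on $\mathbb{R}$.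
   Context: Inputs. $\mathbb{N}=\{1,2,\ldots\}$, $\mathbb{N}_0=\mathbb{N}\cup\{0\}$. $(\Omega,\mathcal{F},\mathbb{P})$ is a probability space, $\mathbb{A}^N=\times_{k=1}^N[a_k,b_k]$ with finite reals $a_k<b_k$, $\mathcal{B}^N$ is the Borel $\sigma$-algebra on $\mathbb{A}^N$, and $\mathbf{X}=(X_1,\ldots,X_N)^\intercal:(\Omega,\mathcal{F})\to(\mathbb{A}^N,\mathcal{B}^N)$ is a random vector such that: (1) the $X_k$ are statistically independent (not necessarily identically distributed); (2) each $X_k$ takes values in $[a_k,b_k]$ (so all its moments are finite); (3) each $X_k$ has an absolutely continuous distribution function and a density $f_{X_k}$, continuous on $[a_k,b_k]$, with support $[a_k,b_k]$ (the closure of $\{f_{X_k}>0\}$). The joint density is $f_{\mathbf{X}}(\mathbf{x})=\prod_{k=1}^Nf_{X_k}(x_k)$, with support $\mathbb{A}^N$. $L^2(\Omega,\mathcal{F},\mathbb{P})$ denotes the space of (classes of) random variables $y(\mathbf{X})$, $y:\mathbb{A}^N\to\mathbb{R}$ measurable, with $\mathbb{E}|y(\mathbf{X})|^2<\infty$. Univariate B-splines. For each $k$, let $n_k>p_k\ge0$ be integers and let $\boldsymbol{\xi}_k=\{\xi_{k,1}\le\cdots\le\xi_{k,n_k+p_k+1}\}$ be a $(p_k+1)$-open knot sequence on $[a_k,b_k]$: its distinct values are $a_k=\zeta_{k,1}<\cdots<\zeta_{k,r_k}=b_k$, with multiplicities $m_{k,1}=m_{k,r_k}=p_k+1$ and $1\le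 m_{k,j}\le p_k+1$ for $2\le j\le r_k-1$. B-splines: $B^k_{i,0,\boldsymbol{\xi}_k}(x)=1$ if $\xi_{k,i}\le x<\xi_{k,i+1}$ and $0$ otherwise; for $q\ge1$, $B^k_{i,q,\boldsymbol{\xi}_k}(x)=\frac{x-\xi_{k,i}}{\xi_{k,i+q}-\xi_{k,i}}B^k_{i,q-1,\boldsymbol{\xi}_k}(x)+\frac{\xi_{k,i+q+1}-x}{\xi_{k,i+q+1}-\xi_{k,i+1}}B^k_{i+1,q-1,\boldsymbol{\xi}_k}(x)$, terms with zero denominator being zero; values at $x=b_k$ are taken as left limits. The degree-$p_k$ B-splines are $B^k_{i,p_k,\boldsymbol{\xi}_k}$, $1\le i\le n_k$. Orthonormal B-splines and SCE. $\mathbf{P}_k(x_k)=(1,B^k_{2,p_k,\boldsymbol{\xi}_k}(x_k),\ldots,B^k_{n_k,p_k,\boldsymbol{\xi}_k}(x_k))^\intercal$, $\mathbf{G}_k=\mathbb{E}[\mathbf{P}_k(X_k)\mathbf{P}_k^\intercal(X_k)]$ (symmetric positive-definite), $\mathbf{G}_k=\mathbf{Q}_k\mathbf{Q}_k^\intercal$ is the Cholesky factorization ($\mathbf{Q}_k$ lower triangular with positive diagonal), and $\boldsymbol{\psi}_k(x_k)=(\psi^k_{1,p_k,\boldsymbol{\xi}_k}(x_k),\ldots,\psi^k_{n_k,p_k,\boldsymbol{\xi}_k}(x_k))^\intercal=\mathbf{Q}_k^{-1}\mathbf{P}_k(x_k)$. For $\mathbf{p}=(p_1,\ldots,p_N)$,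 $\boldsymbol{\Xi}=\{\boldsymbol{\xi}_1,\ldots,\boldsymbol{\xi}_N\}$, $\mathbf{n}=(n_1,\ldots,n_N)$ and $\mathcal{I}_{\mathbf{n}}=\{(i_1,\ldots,i_N):1\le i_k\le n_k\}$, put $\Psi_{\mathbf{i},\mathbf{p},\boldsymbol{\Xi}}(\mathbf{x})=\prod_{k=1}^N\psi^k_{i_k,p_k,\boldsymbol{\xi}_k}(x_k)$. The SCE approximation of $y(\mathbf{X})$ is $y_{\mathbf{p},\boldsymbol{\Xi}}(\mathbf{X})=\sum_{\mathbf{i}\in\mathcal{I}_{\mathbf{n}}}C_{\mathbf{i},\mathbf{p},\boldsymbol{\Xi}}\Psi_{\mathbf{i},\mathbf{p},\boldsymbol{\Xi}}(\mathbf{X})$ with $C_{\mathbf{i},\mathbf{p},\boldsymbol{\Xi}}=\mathbb{E}[y(\mathbf{X})\Psi_{\mathbf{i},\mathbf{p},\boldsymbol{\Xi}}(\mathbf{X})]$. Mesh sizes. $h_k=\max_{1\le l\le r_k-1}(\zeta_{k,l+1}-\zeta_{k,l})$ and $\mathbf{h}=(h_1,\ldots,h_N)$. The limit $\mathbf{h}\to\mathbf{0}$ is taken with $\mathbf{p}$ fixed, along arbitrary sequences of families $\boldsymbol{\Xi}$ of $(p_k+1)$-open knot sequences whose vectors of largest element sizes tend to $\mathbf{0}$. *)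

theory Defs
  imports
    "HOL-Probability.Probability"
    "Jordan_Normal_Form.Gauss_Jordan_Elimination"
begin

no_notation vec_index (infixl \<open>$\<close> 100)

text \<open>
  A knot sequence \<open>\<xi>\<^sub>1 \<le> \<dots> \<le> \<xi>\<^bsub>n+p+1\<^esub>\<close> is a list of length \<open>n + p + 1\<close>, so the number \<open>n\<close> of
  B-splines is determined by the list and the degree. Knots, B-splines and the
  orthonormal B-splines are numbered from 1, whereas lists, vectors and matrices are
  indexed from 0.
\<close>

definition knot :: "real list \<Rightarrow> nat \<Rightarrow> real" where
  "knot \<xi> i = \<xi> ! (i - 1)"

text \<open>The end points \<open>a\<close> and \<open>b\<close> have multiplicity \<open>p + 1\<close>, so for \<open>a < b\<close> the conditions imply
  \<open>n > p\<close> and the subtraction in \<open>num_bsplines\<close> does not truncate.\<close>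

definition open_knots :: "real \<Rightarrow> real \<Rightarrow> nat \<Rightarrow> real list \<Rightarrow> bool" where
  "open_knots a b p \<xi> \<longleftrightarrow>
     sorted \<xi> \<and> set \<xi> \<subseteq> {a..b} \<and>
     count_list \<xi> a = p + 1 \<and> count_list \<xi> b = p + 1 \<and>
     (\<forall>z\<in>set \<xi>. count_list \<xi> z \<le> p + 1)"

definition num_bsplines :: "nat \<Rightarrow> real list \<Rightarrow> nat" where
  "num_bsplines p \<xi> = length \<xi> - (p + 1)"

definition breakpoints :: "real list \<Rightarrow> real list" where
  "breakpoints \<xi> = sorted_list_of_set (set \<xi>)"

definition mesh_size :: "real list \<Rightarrow> real" where
  "mesh_size \<xi> = Max {breakpoints \<xi> ! (l + 1) - breakpoints \<xi> ! l | l. l + 1 < length (breakpoints \<xi>)}"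

text \<open>The terms of the recursion with zero denominator vanish, because \<open>u / 0 = 0\<close>.\<close>

fun bspline_rec :: "real list \<Rightarrow> nat \<Rightarrow> nat \<Rightarrow> real \<Rightarrow> real" where
  "bspline_rec \<xi> 0 i x = (if knot \<xi> i \<le> x \<and> x < knot \<xi> (i + 1) then 1 else 0)"
| "bspline_rec \<xi> (Suc q) i x =
     (x - knot \<xi> i) / (knot \<xi> (i + Suc q) - knot \<xi> i) * bspline_rec \<xi> q i x +
     (knot \<xi> (i + Suc q + 1) - x) / (knot \<xi> (i + Suc q + 1) - knot \<xi> (i + 1)) * bspline_rec \<xi> q (i + 1) x"

text \<open>At the right end point (the last knot) the value is the left limit.\<close>

definition bspline :: "real list \<Rightarrow> nat \<Rightarrow> nat \<Rightarrow> real \<Rightarrow> real" where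
  "bspline \<xi> q i x =
     (if x = last \<xi> then Lim (at_left x) (bspline_rec \<xi> q i) else bspline_rec \<xi> q i x)"

definition aux_basis :: "nat \<Rightarrow> real list \<Rightarrow> real \<Rightarrow> real vec" where
  "aux_basis p \<xi> x =
     vec (num_bsplines p \<xi>) (\<lambda>i. if i = 0 then 1 else bspline \<xi> p (i + 1) x)"

definition gram_matrix :: "'w measure \<Rightarrow> ('w \<Rightarrow> real) \<Rightarrow> nat \<Rightarrow> real list \<Rightarrow> real mat" where
  "gram_matrix M Z p \<xi> =
     mat (num_bsplines p \<xi>) (num_bsplines p \<xi>)
       (\<lambda>(i, j). LINT \<omega>|M. vec_index (aux_basis p \<xi> (Z \<omega>)) i * vec_index (aux_basis p \<xi> (Z \<omega>)) j)"

definition is_cholesky_factor :: "real mat \<Rightarrow> real mat \<Rightarrow> bool" where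
  "is_cholesky_factor G Q \<longleftrightarrow>
     Q \<in> carrier_mat (dim_row G) (dim_row G) \<and>
     (\<forall>i<dim_row G. \<forall>j<dim_row G. i < j \<longrightarrow> Q $$ (i, j) = 0) \<and>
     (\<forall>i<dim_row G. 0 < Q $$ (i, i)) \<and>
     G = Q * transpose_mat Q"

text \<open>A symmetric positive-definite matrix has exactly one such factor.\<close>

definition cholesky_factor :: "real mat \<Rightarrow> real mat" where
  "cholesky_factor G = (THE Q. is_cholesky_factor G Q)"

definition orth_bspline ::
    "'w measure \<Rightarrow> ('w \<Rightarrow> real) \<Rightarrow> nat \<Rightarrow> real list \<Rightarrow> nat \<Rightarrow> real \<Rightarrow> real" where
  "orth_bspline M Z p \<xi> i x =
     vec_index (the (mat_inverse (cholesky_factor (gram_matrix M Z p \<xi>))) *\<^sub>v aux_basis p \<xi> x) (i - 1)"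

definition multi_indices :: "('n \<Rightarrow> nat) \<Rightarrow> ('n \<Rightarrow> real list) \<Rightarrow> ('n \<Rightarrow> nat) set" where
  "multi_indices p \<Xi> = {i. \<forall>k. 1 \<le> i k \<and> i k \<le> num_bsplines (p k) (\<Xi> k)}"

definition mv_orth_bspline ::
    "'w measure \<Rightarrow> ('w \<Rightarrow> real ^ 'n) \<Rightarrow> ('n \<Rightarrow> nat) \<Rightarrow> ('n \<Rightarrow> real list) \<Rightarrow> ('n \<Rightarrow> nat) \<Rightarrow>
     real ^ 'n \<Rightarrow> real" where
  "mv_orth_bspline M X p \<Xi> i x =
     (\<Prod>k\<in>UNIV. orth_bspline M (\<lambda>\<omega>. X \<omega> $ k) (p k) (\<Xi> k) (i k) (x $ k))"

definition sce_coeff ::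
    "'w measure \<Rightarrow> ('w \<Rightarrow> real ^ 'n) \<Rightarrow> ('n \<Rightarrow> nat) \<Rightarrow> ('n \<Rightarrow> real list) \<Rightarrow>
     (real ^ 'n \<Rightarrow> real) \<Rightarrow> ('n \<Rightarrow> nat) \<Rightarrow> real" where
  "sce_coeff M X p \<Xi> y i = (LINT \<omega>|M. y (X \<omega>) * mv_orth_bspline M X p \<Xi> i (X \<omega>))"

definition sce ::
    "'w measure \<Rightarrow> ('w \<Rightarrow> real ^ 'n) \<Rightarrow> ('n \<Rightarrow> nat) \<Rightarrow> ('n \<Rightarrow> real list) \<Rightarrow>
     (real ^ 'n \<Rightarrow> real) \<Rightarrow> real ^ 'n \<Rightarrow> real" where
  "sce M X p \<Xi> y x =
     (\<Sum>i\<in>multi_indices p \<Xi>. sce_coeff M X p \<Xi> y i * mv_orth_bspline M X p \<Xi> i x)"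

end

theory Submission
  imports Defs "Jordan_Normal_Form.Determinant"
begin

text \<open>
  The spline expansion of \<open>y(X)\<close> is its orthogonal projection, in the space of square-integrable
  random variables, onto the span of the tensor-product B-splines. Its mean-square error is
  therefore at most that of \<^emph>\<open>any\<close> tensor-product spline (\<open>orthonormal_best_approximation\<close>), so one
  good spline for each mesh is enough.

  To find it, replace \<open>y\<close> by a continuous function \<open>g\<close> that is close to it in mean square under the
  law of \<open>X\<close> (\<open>continuous_functions_dense_in_L2\<close>). On the compact box \<open>g\<close> is uniformly continuous,
  and the spline whose coefficients are the values of \<open>g\<close> at the knots is uniformly close to it:
  the B-splines are nonnegative and sum to 1, so the spline averages values of \<open>g\<close>, and only values
  at distance at most \<open>(p\<^sub>k + 1) h\<^sub>k\<close> in each coordinate enter (\<open>quasi_interpolant_error\<close>).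

  That the expansion is such a projection needs the Cholesky factor of each Gram matrix to exist and
  to be unique, hence the Gram matrix to be positive definite, hence the B-splines to be linearly
  independent modulo null sets of the law of \<open>X\<^sub>k\<close>. This law charges every subinterval of
  \<open>[a\<^sub>k, b\<^sub>k]\<close>, so a combination that vanishes almost surely has zeros arbitrarily close to the
  right of every point. Among the B-splines starting at a given knot, each one vanishes there to a
  different order, so looking at the leftmost nonzero coefficient gives a contradiction
  (\<open>bspline_rec_leading_order\<close>, \<open>bsplines_independent\<close>). Whitening with the inverse Cholesky factor then
  yields an orthonormal basis of the same spline space, and independence of the coordinates carries
  orthonormality over to the products (\<open>mv_orth_bspline_orthonormal\<close>).

  Convergence in probability follows from Markov's inequality and convergence in distribution by
  shifting the argument of the distribution function. A continuous distribution function is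
  uniformly continuous, so in that case the shift is harmless uniformly in the argument
  (\<open>continuous_distribution_function_uniformly_continuous\<close>).
\<close>

section \<open>B-splines on a sorted knot list\<close>

lemma knot_mono:
  assumes "sorted \<xi>" "1 \<le> i" "i \<le> j" "j \<le> length \<xi>"
  shows "knot \<xi> i \<le> knot \<xi> j"
  unfolding knot_def using assms by (intro sorted_nth_mono) auto

lemma bspline_rec_eq_0:
  assumes "sorted \<xi>" "1 \<le> i" "i + q + 1 \<le> length \<xi>" "x < knot \<xi> i \<or> knot \<xi> (i + q + 1) \<le> x"
  shows "bspline_rec \<xi> q i x = 0"
  using assms(2-)
proof (induction q arbitrary: i)
  case (Suc q)
  have "knot \<xi> i \<le> knot \<xi> (i + 1)" "knot \<xi> (i + q + 1) \<le> knot \<xi> (i + q + 2)"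
    using Suc.prems by (auto intro!: knot_mono assms)
  then have "x < knot \<xi> i \<or> knot \<xi> (i + q + 1) \<le> x" if "bspline_rec \<xi> q i x \<noteq> 0"
    and "x < knot \<xi> i \<or> knot \<xi> (i + q + 2) \<le> x"
    using that by auto
  then have "bspline_rec \<xi> q i x = 0" "bspline_rec \<xi> q (i + 1) x = 0"
    using Suc.prems Suc.IH[of i] Suc.IH[of "i + 1"] \<open>knot \<xi> i \<le> knot \<xi> (i + 1)\<close>
      \<open>knot \<xi> (i + q + 1) \<le> knot \<xi> (i + q + 2)\<close> by (auto simp: add.commute add.left_commute)
  then show ?case
    by simp
qed auto

lemma bspline_rec_nonneg:
  assumes "sorted \<xi>" "1 \<le> i" "i + q + 1 \<le> length \<xi>"
  shows "0 \<le> bspline_rec \<xi> q i x"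
  using assms(2-)
proof (induction q arbitrary: i)
  case (Suc q)
  have le: "knot \<xi> i \<le> knot \<xi> (i + Suc q)" "knot \<xi> (i + 1) \<le> knot \<xi> (i + Suc q + 1)"
    using Suc.prems by (auto intro!: knot_mono assms)
  have "0 \<le> (x - knot \<xi> i) * bspline_rec \<xi> q i x"
    using Suc.IH[of i] Suc.prems bspline_rec_eq_0[OF assms(1), of i q x]
    by (cases "x < knot \<xi> i") auto
  moreover have "0 \<le> (knot \<xi> (i + Suc q + 1) - x) * bspline_rec \<xi> q (i + 1) x"
    using Suc.IH[of "i + 1"] Suc.prems bspline_rec_eq_0[OF assms(1), of "i + 1" q x]
    by (cases "x < knot \<xi> (i + Suc q + 1)") auto
  ultimately show ?case
    using le by (auto simp: divide_simps intro!: add_nonneg_nonneg)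
qed auto

lemma borel_measurable_bspline_rec [measurable]: "bspline_rec \<xi> q i \<in> borel_measurable borel"
proof (induction q arbitrary: i)
  case (Suc q)
  note [measurable] = Suc.IH
  show ?case
    unfolding bspline_rec.simps by measurable
next
  case 0
  have "bspline_rec \<xi> 0 i = (\<lambda>x. if knot \<xi> i \<le> x \<and> x < knot \<xi> (i + 1) then 1 else 0)"
    by (simp add: fun_eq_iff)
  then show ?case
    by simp
qed

lemma borel_measurable_bspline [measurable]: "bspline \<xi> q i \<in> borel_measurable borel"
proof -
  have "bspline \<xi> q i = (\<lambda>x. if x = last \<xi> then Lim (at_left (last \<xi>)) (bspline_rec \<xi> q i) else bspline_rec \<xi> q i x)"
    by (auto simp: bspline_def fun_eq_iff)
  also have "\<dots> \<in> borel_measurable borel"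
    by measurable
  finally show ?thesis .
qed

text \<open>
  At a knot \<open>z\<close> that occurs \<open>m\<close> times at the start of its support, a B-spline of degree \<open>q\<close> grows
  like \<open>(x - z)\<^bsup>q + 1 - m\<^esup>\<close> to the right of \<open>z\<close>. In the recursion the first term keeps \<open>m\<close> and gains a
  factor \<open>x - z\<close>, the second loses one copy of \<open>z\<close>. So both have the order of the claim and a
  nonnegative coefficient, and at least one of the coefficients is positive.
\<close>

lemma bspline_rec_leading_order:
  assumes "sorted \<xi>" "1 \<le> j" "j + q + 1 \<le> length \<xi>"
    and "1 \<le> m" "m \<le> q + 1" "\<And>l. l < m \<Longrightarrow> knot \<xi> (j + l) = z" "z < knot \<xi> (j + m)"
  shows "\<exists>c>0. ((\<lambda>x. bspline_rec \<xi> q j x / (x - z) ^ (q + 1 - m)) \<longlongrightarrow> c) (at_right z)"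
  using assms(2-)
proof (induction q arbitrary: j m)
  case 0
  have [simp]: "m = 1" "knot \<xi> j = z"
    using 0 by auto
  have "eventually (\<lambda>x. bspline_rec \<xi> 0 j x = 1) (at_right z)"
    using eventually_at_right_real[OF 0(6)] by eventually_elim auto
  then show ?case
    by (intro exI[of _ 1]) (auto intro: tendsto_eventually)
next
  case (Suc q)
  \<comment> \<open>The two terms of the recursion; the first is 0 for \<open>m = q + 2\<close>, the second vanishes near \<open>z\<close> for \<open>m = 1\<close>.\<close>
  define u where "u = (\<lambda>x. (x - z) / (knot \<xi> (j + Suc q) - z) * bspline_rec \<xi> q j x)"
  define v where "v = (\<lambda>x. (knot \<xi> (j + Suc q + 1) - x) / (knot \<xi> (j + Suc q + 1) - knot \<xi> (j + 1)) * bspline_rec \<xi> q (j + 1) x)"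
  have zj: "knot \<xi> j = z"
    using Suc.prems(5)[of 0] Suc.prems(3) by auto
  have split: "bspline_rec \<xi> (Suc q) j x = u x + v x" for x
    by (simp add: u_def v_def zj)
  have pos: "eventually (\<lambda>x. x > z) (at_right z)"
    by (auto simp: eventually_at_filter)
  have u: "\<exists>c. (if m \<le> q + 1 then 0 < c else c = 0) \<and> ((\<lambda>x. u x / (x - z) ^ (Suc q + 1 - m)) \<longlongrightarrow> c) (at_right z)"
  proof (cases "m \<le> q + 1")
    case True
    obtain c where c: "c > 0" "((\<lambda>x. bspline_rec \<xi> q j x / (x - z) ^ (q + 1 - m)) \<longlongrightarrow> c) (at_right z)"
      using Suc.IH[of j m] Suc.prems True by auto
    have lt: "z < knot \<xi> (j + Suc q)"
      using Suc.prems True knot_mono[OF assms(1), of "j + m" "j + Suc q"] by auto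
    have "eventually (\<lambda>x. bspline_rec \<xi> q j x / (x - z) ^ (q + 1 - m) / (knot \<xi> (j + Suc q) - z)
        = u x / (x - z) ^ (Suc q + 1 - m)) (at_right z)"
      using pos
    proof eventually_elim
      case (elim x)
      have "Suc q + 1 - m = Suc (q + 1 - m)"
        using True by simp
      then show ?case
        using elim by (simp add: u_def)
    qed
    moreover have "((\<lambda>x. bspline_rec \<xi> q j x / (x - z) ^ (q + 1 - m) / (knot \<xi> (j + Suc q) - z)) \<longlongrightarrow>
        c / (knot \<xi> (j + Suc q) - z)) (at_right z)"
      using lt by (intro tendsto_intros c) auto
    ultimately have "((\<lambda>x. u x / (x - z) ^ (Suc q + 1 - m)) \<longlongrightarrow> c / (knot \<xi> (j + Suc q) - z)) (at_right z)"
      by (rule Lim_transform_eventually[rotated])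
    then show ?thesis
      using c lt True by (intro exI[of _ "c / (knot \<xi> (j + Suc q) - z)"]) auto
  next
    case False
    then have "knot \<xi> (j + Suc q) = z"
      using Suc.prems(4) Suc.prems(5)[of "Suc q"] by auto
    then show ?thesis
      using False by (intro exI[of _ 0]) (auto simp: u_def)
  qed
  have v: "\<exists>c. (if 2 \<le> m then 0 < c else c = 0) \<and> ((\<lambda>x. v x / (x - z) ^ (Suc q + 1 - m)) \<longlongrightarrow> c) (at_right z)"
  proof (cases "2 \<le> m")
    case True
    have zj1: "knot \<xi> (j + 1) = z"
      using Suc.prems(5)[of 1] True by auto
    have lt: "z < knot \<xi> (j + Suc q + 1)"
      using Suc.prems knot_mono[OF assms(1), of "j + m" "j + Suc q + 1"] by auto
    have "\<exists>c>0. ((\<lambda>x. bspline_rec \<xi> q (j + 1) x / (x - z) ^ (q + 1 - (m - 1))) \<longlongrightarrow> c) (at_right z)"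
      using Suc.prems True Suc.prems(5)[of "Suc l" for l] by (intro Suc.IH) auto
    then obtain c where c: "c > 0" "((\<lambda>x. bspline_rec \<xi> q (j + 1) x / (x - z) ^ (q + 1 - (m - 1))) \<longlongrightarrow> c) (at_right z)"
      by blast
    have "((\<lambda>x. (knot \<xi> (j + Suc q + 1) - x) / (knot \<xi> (j + Suc q + 1) - z) *
        (bspline_rec \<xi> q (j + 1) x / (x - z) ^ (q + 1 - (m - 1)))) \<longlongrightarrow>
        (knot \<xi> (j + Suc q + 1) - z) / (knot \<xi> (j + Suc q + 1) - z) * c) (at_right z)"
      using lt by (intro tendsto_intros c) auto
    moreover have "q + 1 - (m - 1) = Suc q + 1 - m"
      using True by simp
    ultimately show ?thesis
      using c lt True by (intro exI[of _ c]) (auto simp: v_def zj1[simplified])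
  next
    case False
    then have m: "m = 1"
      using Suc.prems by auto
    have "eventually (\<lambda>x. x < knot \<xi> (j + 1)) (at_right z)"
      using Suc.prems m eventually_at_right_real[of z "knot \<xi> (j + 1)"] by (auto elim: eventually_mono)
    then have "eventually (\<lambda>x. v x / (x - z) ^ (Suc q + 1 - m) = 0) (at_right z)"
    proof eventually_elim
      case (elim x)
      then have "bspline_rec \<xi> q (j + 1) x = 0"
        using Suc.prems by (intro bspline_rec_eq_0 assms) auto
      then show ?case
        by (simp add: v_def)
    qed
    then show ?thesis
      using False by (intro exI[of _ 0]) (auto intro: tendsto_eventually)
  qed
  obtain c where c: "if m \<le> q + 1 then 0 < c else c = 0"
      "((\<lambda>x. u x / (x - z) ^ (Suc q + 1 - m)) \<longlongrightarrow> c) (at_right z)"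
    using u by blast
  obtain d where d: "if 2 \<le> m then 0 < d else d = 0"
      "((\<lambda>x. v x / (x - z) ^ (Suc q + 1 - m)) \<longlongrightarrow> d) (at_right z)"
    using v by blast
  have "0 < c + d"
    using c(1) d(1) Suc.prems by (auto split: if_splits)
  then show ?case
    using tendsto_add[OF c(2) d(2)] unfolding split by (intro exI[of _ "c + d"]) (auto simp: add_divide_distrib)
qed

section \<open>B-splines on an open knot sequence\<close>

locale open_knot_sequence =
  fixes a b :: real and p :: nat and \<xi> :: "real list"
  assumes a_less_b: "a < b" and open_knots: "open_knots a b p \<xi>"
begin

abbreviation n :: nat where "n \<equiv> num_bsplines p \<xi>"

lemma sorted_knots: "sorted \<xi>"
  using open_knots by (simp add: open_knots_def)

lemma count_knots: "count_list \<xi> z = card {i. i < length \<xi> \<and> \<xi> ! i = z}"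
  by (simp add: count_list_eq_length_filter length_filter_conv_card eq_commute)

lemma knots_in_interval: "1 \<le> i \<Longrightarrow> i \<le> length \<xi> \<Longrightarrow> knot \<xi> i \<in> {a..b}"
  using open_knots by (auto simp: open_knots_def knot_def subset_iff)

lemma length_knots: "length \<xi> = n + p + 1" and degree_less_num_bsplines: "p < n"
proof -
  have "card {i. i < length \<xi> \<and> \<xi> ! i = a} + card {i. i < length \<xi> \<and> \<xi> ! i = b} =
      card ({i. i < length \<xi> \<and> \<xi> ! i = a} \<union> {i. i < length \<xi> \<and> \<xi> ! i = b})"
    using a_less_b by (intro card_Un_disjoint[symmetric]) auto
  also have "\<dots> \<le> card {..<length \<xi>}"
    by (intro card_mono) auto
  finally have "2 * (p + 1) \<le> length \<xi>"
    using open_knots unfolding open_knots_def count_knots by auto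
  then show "length \<xi> = n + p + 1" "p < n"
    by (auto simp: num_bsplines_def)
qed

lemma knot_left: "knot \<xi> i = a" if "1 \<le> i" "i \<le> p + 1"
proof (rule ccontr)
  assume ne: "knot \<xi> i \<noteq> a"
  have "a < knot \<xi> i"
    using ne knots_in_interval[of i] that length_knots by auto
  then have "j + 1 < i" if "j < length \<xi>" "\<xi> ! j = a" for j
    using knot_mono[OF sorted_knots, of i "j + 1"] that \<open>1 \<le> i\<close> by (force simp: knot_def)
  then have "card {j. j < length \<xi> \<and> \<xi> ! j = a} \<le> card {..<i - 1}"
    by (intro card_mono) (auto simp: less_diff_conv)
  then show False
    using open_knots that unfolding open_knots_def count_knots by auto
qed

lemma knot_right: "knot \<xi> i = b" if "n + 1 \<le> i" "i \<le> length \<xi>"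
proof (rule ccontr)
  assume ne: "knot \<xi> i \<noteq> b"
  have "knot \<xi> i < b"
    using ne knots_in_interval[of i] that length_knots by auto
  then have "i < j + 1" if "j < length \<xi>" "\<xi> ! j = b" for j
    using knot_mono[OF sorted_knots, of "j + 1" i] that \<open>i \<le> length \<xi>\<close> by (force simp: knot_def)
  then have "card {j. j < length \<xi> \<and> \<xi> ! j = b} \<le> card {i..<length \<xi>}"
    by (intro card_mono) (auto simp: less_Suc_eq_le)
  then show False
    using open_knots that length_knots unfolding open_knots_def count_knots by auto
qed

lemma last_knot: "last \<xi> = b"
  using knot_right[of "length \<xi>"] length_knots by (cases "\<xi> = []") (auto simp: knot_def last_conv_nth)

text \<open>
  This is where the bound \<open>p + 1\<close> on the multiplicities enters: no B-spline has an empty support.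
\<close>

lemma knot_less: "knot \<xi> i < knot \<xi> (i + p + 1)" if "1 \<le> i" "i \<le> n"
proof (rule ccontr)
  assume "\<not> ?thesis"
  then have eq: "knot \<xi> j = knot \<xi> i" if "i \<le> j" "j \<le> i + p + 1" for j
    using knot_mono[OF sorted_knots, of i j] knot_mono[OF sorted_knots, of j "i + p + 1"] that
      length_knots \<open>1 \<le> i\<close> \<open>i \<le> n\<close> by auto
  have "{i - 1..i + p} \<subseteq> {j. j < length \<xi> \<and> \<xi> ! j = knot \<xi> i}"
  proof
    fix j assume j: "j \<in> {i - 1..i + p}"
    then have "knot \<xi> (Suc j) = knot \<xi> i"
      using that by (intro eq) auto
    then show "j \<in> {j. j < length \<xi> \<and> \<xi> ! j = knot \<xi> i}"
      using j that length_knots by (auto simp: knot_def)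
  qed
  then have "card {i - 1..i + p} \<le> count_list \<xi> (knot \<xi> i)"
    unfolding count_knots by (intro card_mono) auto
  moreover have "count_list \<xi> (knot \<xi> i) \<le> p + 1"
    using open_knots that length_knots by (auto simp: open_knots_def knot_def)
  ultimately show False
    using that by auto
qed

text \<open>
  The mesh size is measured between neighbouring breakpoints, that is, without repetitions. The
  breakpoint after \<open>knot \<xi> i\<close> is itself a later knot and so not below the next knot.
\<close>

lemma knot_diff_le_mesh_size:
  assumes "1 \<le> i" "i < length \<xi>"
  shows "knot \<xi> (i + 1) - knot \<xi> i \<le> mesh_size \<xi>"
proof -
  let ?B = "breakpoints \<xi>"
  have inner: "knot \<xi> (i + 1) - knot \<xi> i \<le> mesh_size \<xi>" if i: "1 \<le> i" "i < length \<xi>" "knot \<xi> i < b" for i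
  proof -
    have B: "set ?B = set \<xi>" "sorted_wrt (<) ?B"
      by (auto simp: breakpoints_def)
    have "knot \<xi> i \<in> set ?B"
      using i by (auto simp: B knot_def)
    then obtain l where l: "l < length ?B" "?B ! l = knot \<xi> i"
      by (auto simp: in_set_conv_nth)
    have "b \<in> set ?B"
      using last_knot length_knots unfolding B by (metis last_in_set list.size(3) not_add_less2 less_one add_gr_0 less_irrefl)
    then obtain r where r: "r < length ?B" "?B ! r = b"
      by (auto simp: in_set_conv_nth)
    have "l < r"
      using l r i B(2) by (metis less_asym linorder_neqE_nat order_less_irrefl sorted_wrt_nth_less)
    then have l1: "l + 1 < length ?B"
      using r by simp
    then have "?B ! (l + 1) \<in> set \<xi>"
      using B nth_mem by blast
    then obtain k where "k < length \<xi>" "?B ! (l + 1) = \<xi> ! k"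
      by (auto simp: in_set_conv_nth)
    then obtain j where j: "1 \<le> j" "j \<le> length \<xi>" "?B ! (l + 1) = knot \<xi> j"
      using that[of "Suc k"] by (auto simp: knot_def)
    have "knot \<xi> i < knot \<xi> j"
      using B(2) l l1 j by (metis less_add_one sorted_wrt_nth_less)
    then have "i < j"
      using knot_mono[OF sorted_knots, of j i] j i by force
    then have "knot \<xi> (i + 1) \<le> knot \<xi> j"
      using j i by (intro knot_mono sorted_knots) auto
    then have "knot \<xi> (i + 1) - knot \<xi> i \<le> ?B ! (l + 1) - ?B ! l"
      using j l by simp
    also have "\<dots> \<le> mesh_size \<xi>"
      unfolding mesh_size_def using l1
      by (intro Max_ge finite_subset[OF _ finite_imageI[of "{..<length ?B}" "\<lambda>l. ?B ! (l + 1) - ?B ! l"]]) auto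
    finally show ?thesis .
  qed
  \<comment> \<open>For a knot equal to \<open>b\<close> there is no next breakpoint; then the claim is that the mesh size is
    nonnegative, which the first knot \<open>a < b\<close> shows.\<close>
  have "0 \<le> knot \<xi> (1 + 1) - knot \<xi> 1"
    using length_knots degree_less_num_bsplines knot_mono[OF sorted_knots, of 1 2] by (auto simp: numeral_2_eq_2)
  also have "\<dots> \<le> mesh_size \<xi>"
    using length_knots degree_less_num_bsplines a_less_b knot_left[of 1] by (intro inner) auto
  finally have "0 \<le> mesh_size \<xi>" .
  then show ?thesis
    using inner[of i] knots_in_interval[of i] knots_in_interval[of "i + 1"] assms
    by (cases "knot \<xi> i < b") auto
qed

lemma bspline_support_width:
  assumes "1 \<le> i" "i \<le> n" "bspline_rec \<xi> p i x \<noteq> 0"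
  shows "\<bar>x - knot \<xi> i\<bar> \<le> real (p + 1) * mesh_size \<xi>"
proof -
  have "knot \<xi> i \<le> x" "x < knot \<xi> (i + p + 1)"
    using bspline_rec_eq_0[OF sorted_knots, of i p x] assms length_knots by force+
  moreover have "knot \<xi> (i + l) - knot \<xi> i \<le> real l * mesh_size \<xi>" if "l \<le> p + 1" for l
    using that
  proof (induction l)
    case (Suc l)
    then show ?case
      using knot_diff_le_mesh_size[of "i + l"] assms length_knots by (auto simp: algebra_simps)
  qed auto
  from this[of "p + 1"] have "knot \<xi> (i + p + 1) - knot \<xi> i \<le> real (p + 1) * mesh_size \<xi>"
    by (simp add: add.assoc)
  ultimately show ?thesis
    by auto
qed

text \<open>
  Induction on the degree: in two neighbouring instances of the recursion the B-spline of lower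
  degree that they share gets the weights \<open>w\<close> and \<open>1 - w\<close>, so the sum telescopes to the sum for the
  lower degree. The sum of degree \<open>q\<close> starts at \<open>p + 1 - q\<close> because the earlier B-splines of this degree
  have the single point \<open>a\<close> as their knots.
\<close>

lemma sum_bsplines_eq_1:
  assumes "a \<le> x" "x < b"
  shows "(\<Sum>i=1..n. bspline_rec \<xi> p i x) = 1"
proof -
  have "(\<Sum>i=p + 1 - q..n. bspline_rec \<xi> q i x) = 1" if "q \<le> p" for q
    using that
  proof (induction q)
    case 0
    \<comment> \<open>In degree 0 the only nonzero summand belongs to the half-open knot interval containing \<open>x\<close>.\<close>
    define j where "j = Max {i\<in>{p + 1..n}. knot \<xi> i \<le> x}"
    have fin: "finite {i\<in>{p + 1..n}. knot \<xi> i \<le> x}" and ne: "p + 1 \<in> {i\<in>{p + 1..n}. knot \<xi> i \<le> x}"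
      using degree_less_num_bsplines knot_left[of "p + 1"] assms by auto
    have "j \<in> {i\<in>{p + 1..n}. knot \<xi> i \<le> x}"
      unfolding j_def using ne by (intro Max_in fin) blast
    then have j: "j \<in> {p + 1..n}" "knot \<xi> j \<le> x"
      by auto
    have j_max: "i \<le> j" if "i \<in> {i\<in>{p + 1..n}. knot \<xi> i \<le> x}" for i
      unfolding j_def by (rule Max_ge[OF fin that])
    have j1: "x < knot \<xi> (j + 1)"
    proof (cases "j = n")
      case True
      then show ?thesis
        using knot_right[of "n + 1"] assms length_knots by auto
    next
      case False
      then have "j + 1 \<notin> {i\<in>{p + 1..n}. knot \<xi> i \<le> x}"
        using j_max[of "j + 1"] by linarith
      then show ?thesis
        using False j by auto
    qed
    have "bspline_rec \<xi> 0 i x = (if i = j then 1 else 0)" if "i \<in> {p + 1..n}" for i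
    proof (cases i j rule: linorder_cases)
      case less
      then show ?thesis
        using knot_mono[OF sorted_knots, of "i + 1" j] j length_knots that by auto
    next
      case greater
      then show ?thesis
        using knot_mono[OF sorted_knots, of "j + 1" i] j j1 length_knots that by auto
    qed (use j j1 in auto)
    then show ?case
      using j by (simp add: sum.delta')
  next
    case (Suc q)
    define w where "w i = (x - knot \<xi> i) / (knot \<xi> (i + Suc q) - knot \<xi> i)" for i
    let ?B = "bspline_rec \<xi> q"
    have rec: "bspline_rec \<xi> (Suc q) i x = w i * ?B i x + (1 - w (i + 1)) * ?B (i + 1) x"
      if "i \<in> {p - q..n}" for i
    proof (cases "knot \<xi> (i + Suc q + 1) = knot \<xi> (i + 1)")
      case True
      then have "?B (i + 1) x = 0"
        using that length_knots Suc.prems by (intro bspline_rec_eq_0 sorted_knots) (auto simp: add_ac intro: leI)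
      then show ?thesis
        by (simp add: w_def)
    next
      case False
      then have "(knot \<xi> (i + Suc q + 1) - x) / (knot \<xi> (i + Suc q + 1) - knot \<xi> (i + 1)) = 1 - w (i + 1)"
        by (simp add: w_def field_simps)
      then show ?thesis
        by (simp add: w_def)
    qed
    have left: "?B (p - q) x = 0" and right: "?B (n + 1) x = 0"
      using Suc.prems length_knots assms degree_less_num_bsplines knot_left[of "p + 1"] knot_right[of "n + 1"]
      by (auto intro!: bspline_rec_eq_0 sorted_knots)
    have "(\<Sum>i=p - q..n. bspline_rec \<xi> (Suc q) i x) =
        (\<Sum>i=p - q..n. w i * ?B i x) + (\<Sum>i=p - q..n. (1 - w (Suc i)) * ?B (Suc i) x)"
      unfolding sum.distrib[symmetric] by (intro sum.cong refl) (simp add: rec del: bspline_rec.simps)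
    also have "(\<Sum>i=p - q..n. (1 - w (Suc i)) * ?B (Suc i) x) = (\<Sum>i=Suc (p - q)..Suc n. (1 - w i) * ?B i x)"
      by (rule sum.shift_bounds_cl_Suc_ivl[symmetric])
    also have "\<dots> = (\<Sum>i=p - q..n. (1 - w i) * ?B i x)"
      using left right degree_less_num_bsplines by (simp add: sum.atLeast_Suc_atMost[of "p - q" n])
    also have "(\<Sum>i=p - q..n. w i * ?B i x) + \<dots> = (\<Sum>i=p - q..n. ?B i x)"
      by (simp add: sum.distrib[symmetric] algebra_simps)
    also have "\<dots> = (\<Sum>i=Suc (p - q)..n. ?B i x)"
      using left degree_less_num_bsplines by (simp add: sum.atLeast_Suc_atMost[of "p - q" n])
    also have "Suc (p - q) = p + 1 - q"
      using Suc.prems by simp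
    finally show ?case
      using Suc by simp
  qed
  from this[of p] show ?thesis
    by simp
qed

lemma bspline_rec_le_1:
  assumes "a \<le> x" "x < b" "1 \<le> i" "i \<le> n"
  shows "bspline_rec \<xi> p i x \<le> 1"
proof -
  have "bspline_rec \<xi> p i x \<le> (\<Sum>i=1..n. bspline_rec \<xi> p i x)"
    using assms length_knots by (intro member_le_sum bspline_rec_nonneg sorted_knots) auto
  then show ?thesis
    using sum_bsplines_eq_1 assms by simp
qed

text \<open>
  Let \<open>i\<close> be the first index with a nonzero coefficient and \<open>z\<close> its first knot. To the right of \<open>z\<close> the
  B-splines starting after \<open>z\<close> vanish, and those starting at \<open>z\<close> with index greater than \<open>i\<close> have a
  higher order than number \<open>i\<close>. Hence the sum behaves like a nonzero multiple of one power of
  \<open>x - z\<close> and has no zeros near \<open>z\<close>. Only zeros accumulating at \<open>z\<close> are assumed, because this is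
  all that vanishing almost surely provides.
\<close>

lemma bsplines_independent:
  assumes zero: "\<And>z. a \<le> z \<Longrightarrow> z < b \<Longrightarrow> \<exists>\<^sub>F x in at_right z. (\<Sum>i=1..n. c i * bspline_rec \<xi> p i x) = 0"
    and i: "i \<in> {1..n}"
  shows "c i = 0"
  using i
proof (induction i rule: less_induct)
  case (less i)
  define z where "z = knot \<xi> i"
  have z: "a \<le> z" "z < b"
    using knots_in_interval[of i] knots_in_interval[of "i + p + 1"] knot_less[of i] less.prems length_knots
    by (auto simp: z_def)
  \<comment> \<open>The number of copies of \<open>z\<close> among the knots of B-spline \<open>i\<close>.\<close>
  define m where "m = (LEAST m. z < knot \<xi> (i + m))"
  have ex: "z < knot \<xi> (i + (p + 1))"
    using knot_less[of i] less.prems by (auto simp: z_def add_ac)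
  have m: "z < knot \<xi> (i + m)" "m \<le> p + 1"
    unfolding m_def using LeastI[of "\<lambda>m. z < knot \<xi> (i + m)", OF ex] Least_le[of "\<lambda>m. z < knot \<xi> (i + m)", OF ex] by auto
  have m1: "1 \<le> m"
    using m(1) by (cases m) (auto simp: z_def)
  have eq: "knot \<xi> (i + l) = z" if "l < m" for l
    using not_less_Least[of l "\<lambda>m. z < knot \<xi> (i + m)"] that knot_mono[OF sorted_knots, of i "i + l"] less.prems m length_knots
    unfolding m_def[symmetric] by (auto simp: z_def)
  define e where "e = p + 1 - m"
  define r where "r j x = c j * (bspline_rec \<xi> p j x / (x - z) ^ e)" for j x
  obtain C where C: "C > 0" "((\<lambda>x. bspline_rec \<xi> p i x / (x - z) ^ e) \<longlongrightarrow> C) (at_right z)"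
    using bspline_rec_leading_order[OF sorted_knots, of i p m z] eq m m1 less.prems length_knots
    unfolding e_def by auto
  have r: "(r j \<longlongrightarrow> (if j = i then c i * C else 0)) (at_right z)" if j: "j \<in> {1..n}" for j
  proof -
    consider "j < i" | "j = i" | "i < j" "j < i + m" | "i + m \<le> j"
      by linarith
    then show ?thesis
    proof cases
      case 1
      then have "c j = 0"
        using less j by auto
      then show ?thesis
        using 1 by (simp add: r_def[abs_def])
    next
      case 2
      then show ?thesis
        using tendsto_mult_left[OF C(2), of "c i"] by (simp add: r_def[abs_def])
    next
      case 3
      have "\<exists>C>0. ((\<lambda>x. bspline_rec \<xi> p j x / (x - z) ^ (p + 1 - (i + m - j))) \<longlongrightarrow> C) (at_right z)"
        using 3 eq[of "l + (j - i)" for l] m m1 less.prems j length_knots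
        by (intro bspline_rec_leading_order sorted_knots) (auto simp: add_ac)
      then obtain D where D: "((\<lambda>x. bspline_rec \<xi> p j x / (x - z) ^ (p + 1 - (i + m - j))) \<longlongrightarrow> D) (at_right z)"
        by blast
      have pw: "p + 1 - (i + m - j) = e + (j - i)"
        using 3 m by (auto simp: e_def)
      have "((\<lambda>x. c j * ((bspline_rec \<xi> p j x / (x - z) ^ (p + 1 - (i + m - j))) * (x - z) ^ (j - i))) \<longlongrightarrow>
          c j * (D * (z - z) ^ (j - i))) (at_right z)"
        by (intro tendsto_intros D)
      moreover have "eventually (\<lambda>x. c j * ((bspline_rec \<xi> p j x / (x - z) ^ (p + 1 - (i + m - j))) * (x - z) ^ (j - i)) = r j x) (at_right z)"
        unfolding pw eventually_at_filter by (auto simp: r_def power_add)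
      ultimately show ?thesis
        using 3 by (auto intro: Lim_transform_eventually simp: power_0_left)
    next
      case 4
      have "z < knot \<xi> j"
        using m(1) knot_mono[OF sorted_knots, of "i + m" j] 4 j length_knots m1 by auto
      then have "eventually (\<lambda>x. x < knot \<xi> j) (at_right z)"
        using eventually_at_right_real[of z "knot \<xi> j"] by (auto elim: eventually_mono)
      then have "eventually (\<lambda>x. r j x = 0) (at_right z)"
      proof eventually_elim
        case (elim x)
        then have "bspline_rec \<xi> p j x = 0"
          using j length_knots by (intro bspline_rec_eq_0 sorted_knots) auto
        then show ?case
          by (simp add: r_def)
      qed
      then show ?thesis
        using 4 m1 by (auto intro: tendsto_eventually)
    qed
  qed
  have "((\<lambda>x. \<Sum>j=1..n. r j x) \<longlongrightarrow> (\<Sum>j=1..n. if j = i then c i * C else 0)) (at_right z)"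
    by (intro tendsto_sum r) auto
  also have "(\<Sum>j=1..n. if j = i then c i * C else 0) = c i * C"
    using less.prems by (simp add: sum.delta)
  finally have lim: "((\<lambda>x. \<Sum>j=1..n. r j x) \<longlongrightarrow> c i * C) (at_right z)" .
  have freq: "\<exists>\<^sub>F x in at_right z. (\<Sum>j=1..n. r j x) = 0"
    using zero[OF z]
  proof (rule frequently_elim1)
    fix x assume "(\<Sum>i=1..n. c i * bspline_rec \<xi> p i x) = 0"
    moreover have "(\<Sum>j=1..n. r j x) = (\<Sum>i=1..n. c i * bspline_rec \<xi> p i x) / (x - z) ^ e"
      by (simp add: r_def sum_divide_distrib)
    ultimately show "(\<Sum>j=1..n. r j x) = 0"
      by simp
  qed
  show ?case
  proof (rule ccontr)
    assume "c i \<noteq> 0"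
    then have "eventually (\<lambda>x. (\<Sum>j=1..n. r j x) \<noteq> 0) (at_right z)"
      using C(1) by (intro tendsto_imp_eventually_ne[OF lim]) auto
    then show False
      using freq by (auto simp: frequently_def)
  qed
qed

end

section \<open>Cholesky factorization\<close>

text \<open>
  Elimination of the first variable: the first column of the factor is forced, and the remaining
  block must factor the Schur complement \<open>S\<close>. The form of \<open>S\<close> at \<open>x\<close> is the form of \<open>G\<close> at the extension of
  \<open>x\<close> whose first coordinate minimizes it, so \<open>S\<close> is again positive definite.
\<close>

lemma cholesky_entries_exist:
  fixes G :: "nat \<Rightarrow> nat \<Rightarrow> real"
  assumes "\<And>i j. G i j = G j i"
    and "\<And>x. \<exists>i<n. x i \<noteq> 0 \<Longrightarrow> 0 < (\<Sum>i<n. \<Sum>j<n. x i * x j * G i j)"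
  shows "\<exists>L. (\<forall>i j. i < j \<longrightarrow> L i j = 0) \<and> (\<forall>i<n. 0 < L i i) \<and>
    (\<forall>i<n. \<forall>j<n. G i j = (\<Sum>k<n. L i k * L j k))"
  using assms
proof (induction n arbitrary: G)
  case 0
  show ?case
    by (intro exI[of _ "\<lambda>_ _. 0"]) auto
next
  case (Suc n)
  have sym: "G i j = G j i" for i j
    by (rule Suc.prems(1))
  have "0 < (\<Sum>i<Suc n. \<Sum>j<Suc n. (if i = 0 then 1 else 0) * (if j = 0 then 1 else 0) * G i j)"
    by (rule Suc.prems(2)) auto
  then have pos: "0 < G 0 0"
    by (simp add: sum.lessThan_Suc_shift del: sum.lessThan_Suc)
  define S where "S i j = G (Suc i) (Suc j) - G 0 (Suc i) * G 0 (Suc j) / G 0 0" for i j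
  have "\<exists>L. (\<forall>i j. i < j \<longrightarrow> L i j = 0) \<and> (\<forall>i<n. 0 < L i i) \<and>
    (\<forall>i<n. \<forall>j<n. S i j = (\<Sum>k<n. L i k * L j k))"
  proof (rule Suc.IH)
    show "S i j = S j i" for i j
      by (simp add: S_def sym[of "Suc i" "Suc j"])
    fix x :: "nat \<Rightarrow> real" assume x: "\<exists>i<n. x i \<noteq> 0"
    \<comment> \<open>The minimizing first coordinate is \<open>- s / G 0 0\<close>.\<close>
    define s where "s = (\<Sum>j<n. G 0 (Suc j) * x j)"
    define X where "X i = (case i of 0 \<Rightarrow> - s / G 0 0 | Suc i \<Rightarrow> x i)" for i
    have X_Suc: "X (Suc i) = x i" for i
      by (simp add: X_def)
    have "0 < (\<Sum>i<Suc n. \<Sum>j<Suc n. X i * X j * G i j)"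
      using x by (intro Suc.prems(2)) (auto simp: X_def split: nat.splits)
    also have "\<dots> = X 0 * X 0 * G 0 0 + X 0 * s + (\<Sum>i<n. X 0 * (x i * G (Suc i) 0) + (\<Sum>j<n. x i * x j * G (Suc i) (Suc j)))"
      by (simp add: sum.lessThan_Suc_shift X_Suc s_def sum_distrib_left mult_ac del: sum.lessThan_Suc)
    also have "(\<Sum>i<n. X 0 * (x i * G (Suc i) 0) + (\<Sum>j<n. x i * x j * G (Suc i) (Suc j))) =
        X 0 * s + (\<Sum>i<n. \<Sum>j<n. x i * x j * G (Suc i) (Suc j))"
      by (simp add: sum.distrib s_def sum_distrib_left sym[of "Suc _" 0] mult_ac)
    also have "X 0 * X 0 * G 0 0 + X 0 * s + (X 0 * s + (\<Sum>i<n. \<Sum>j<n. x i * x j * G (Suc i) (Suc j))) =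
        (\<Sum>i<n. \<Sum>j<n. x i * x j * G (Suc i) (Suc j)) - s * s / G 0 0"
      using pos by (simp add: X_def field_simps)
    also have "s * s / G 0 0 = (\<Sum>i<n. \<Sum>j<n. x i * x j * (G 0 (Suc i) * G 0 (Suc j) / G 0 0))"
      unfolding s_def sum_product sum_divide_distrib by (intro sum.cong refl) (simp add: mult_ac)
    also have "(\<Sum>i<n. \<Sum>j<n. x i * x j * G (Suc i) (Suc j)) - \<dots> = (\<Sum>i<n. \<Sum>j<n. x i * x j * S i j)"
      by (simp add: S_def right_diff_distrib sum_subtractf)
    finally show "0 < (\<Sum>i<n. \<Sum>j<n. x i * x j * S i j)" .
  qed
  then obtain L where L: "\<And>i j. i < j \<Longrightarrow> L i j = 0" "\<And>i. i < n \<Longrightarrow> 0 < L i i"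
    "\<And>i j. i < n \<Longrightarrow> j < n \<Longrightarrow> S i j = (\<Sum>k<n. L i k * L j k)"
    by blast
  define K where "K i j = (case (i, j) of (i, 0) \<Rightarrow> G 0 i / sqrt (G 0 0) | (0, Suc j) \<Rightarrow> 0 | (Suc i, Suc j) \<Rightarrow> L i j)" for i j
  have K_simps [simp]: "K i 0 = G 0 i / sqrt (G 0 0)" "K 0 (Suc j) = 0" "K (Suc i) (Suc j) = L i j" for i j
    by (auto simp: K_def split: nat.splits)
  have sq: "sqrt (G 0 0) * sqrt (G 0 0) = G 0 0"
    using pos by simp
  have "K i j = 0" if "i < j" for i j
    using that L(1) by (cases i; cases j) auto
  moreover have "0 < K i i" if "i < Suc n" for i
    using that L(2) pos by (cases i) auto
  moreover have "G i j = (\<Sum>k<Suc n. K i k * K j k)" if "i < Suc n" "j < Suc n" for i j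
  proof (cases i; cases j)
    fix i' j' assume ij: "i = Suc i'" "j = Suc j'"
    have "(\<Sum>k<Suc n. K i k * K j k) = G 0 i * G 0 j / G 0 0 + S i' j'"
      using that pos L(3)[of i' j'] by (simp add: ij sum.lessThan_Suc_shift sq del: sum.lessThan_Suc)
    then show ?thesis
      by (simp add: S_def ij)
  qed (use that pos sym[of "Suc _" 0] in \<open>auto simp: sum.lessThan_Suc_shift sq simp del: sum.lessThan_Suc\<close>)
  ultimately show ?case
    by blast
qed

text \<open>
  The product determines the factor column by column: given the columns before \<open>j\<close>, the entry
  \<open>(j, j)\<close> fixes the square of the diagonal element, and positivity of the latter fixes its sign.
\<close>

lemma cholesky_entries_unique:
  fixes L K :: "nat \<Rightarrow> nat \<Rightarrow> real"
  assumes L: "\<And>i j. i < j \<Longrightarrow> j < n \<Longrightarrow> L i j = 0" "\<And>i. i < n \<Longrightarrow> 0 < L i i"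
    and K: "\<And>i j. i < j \<Longrightarrow> j < n \<Longrightarrow> K i j = 0" "\<And>i. i < n \<Longrightarrow> 0 < K i i"
    and eq: "\<And>i j. i < n \<Longrightarrow> j < n \<Longrightarrow> (\<Sum>k<n. L i k * L j k) = (\<Sum>k<n. K i k * K j k)"
    and "i < n" "j < n"
  shows "L i j = K i j"
  using \<open>j < n\<close> \<open>i < n\<close>
proof (induction j arbitrary: i rule: less_induct)
  case (less j)
  have split: "(\<Sum>k<n. A i k * A j k) = (\<Sum>k<j. A i k * A j k) + A i j * A j j"
    if "\<And>i j. i < j \<Longrightarrow> j < n \<Longrightarrow> A i j = 0" for A :: "nat \<Rightarrow> nat \<Rightarrow> real" and i
  proof -
    have "(\<Sum>k<n. A i k * A j k) = (\<Sum>k<Suc j. A i k * A j k)"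
      using that[of j] less.prems by (intro sum.mono_neutral_right) auto
    then show ?thesis
      by simp
  qed
  have step: "L i j * L j j = K i j * K j j" if "i < n" for i
  proof -
    have "(\<Sum>k<j. L i k * L j k) = (\<Sum>k<j. K i k * K j k)"
      using less.prems that by (intro sum.cong) (auto simp: less.IH)
    then show ?thesis
      using eq[of i j] split[of L i, OF L(1)] split[of K i, OF K(1)] that less.prems by auto
  qed
  have "L j j ^ 2 = K j j ^ 2"
    using step[of j] less.prems by (simp add: power2_eq_square)
  then have "L j j = K j j"
    using L(2)[of j] K(2)[of j] less.prems by (auto intro: less_imp_le dest!: power2_eq_imp_eq)
  then show ?case
    using step[of i] less.prems K(2)[of j] by auto
qed

lemma is_cholesky_factor_cholesky_factor:
  assumes G: "G \<in> carrier_mat n n"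
    and sym: "\<And>i j. i < n \<Longrightarrow> j < n \<Longrightarrow> G $$ (i, j) = G $$ (j, i)"
    and pos: "\<And>x. \<exists>i<n. x i \<noteq> 0 \<Longrightarrow> 0 < (\<Sum>i<n. \<Sum>j<n. x i * x j * G $$ (i, j))"
  shows "is_cholesky_factor G (cholesky_factor G)"
proof -
  have dim: "dim_row G = n" "dim_col G = n"
    using G by auto
  have times: "(Q * transpose_mat Q) $$ (i, j) = (\<Sum>k<n. Q $$ (i, k) * Q $$ (j, k))"
    if "Q \<in> carrier_mat n n" "i < n" "j < n" for Q :: "real mat" and i j
    using that by (auto simp: scalar_prod_def lessThan_atLeast0 intro!: sum.cong)
  define H where "H i j = (if i < n \<and> j < n then G $$ (i, j) else 0)" for i j
  have "\<exists>L. (\<forall>i j. i < j \<longrightarrow> L i j = 0) \<and> (\<forall>i<n. 0 < L i i) \<and>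
    (\<forall>i<n. \<forall>j<n. H i j = (\<Sum>k<n. L i k * L j k))"
    using sym pos by (intro cholesky_entries_exist) (auto simp: H_def)
  then obtain L where L: "\<And>i j. i < j \<Longrightarrow> L i j = 0" "\<And>i. i < n \<Longrightarrow> 0 < L i i"
    "\<And>i j. i < n \<Longrightarrow> j < n \<Longrightarrow> H i j = (\<Sum>k<n. L i k * L j k)"
    by blast
  define Q where "Q = mat n n (\<lambda>(i, j). L i j)"
  have Q: "Q \<in> carrier_mat n n"
    by (simp add: Q_def)
  have factor: "is_cholesky_factor G Q"
    unfolding is_cholesky_factor_def dim
  proof (intro conjI allI impI)
    show "G = Q * transpose_mat Q"
      using L(3) G Q times[OF Q] by (intro eq_matI) (auto simp: H_def Q_def)
  qed (use Q L(1,2) in \<open>auto simp: Q_def\<close>)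
  have unique: "Q' = Q" if Q': "is_cholesky_factor G Q'" for Q'
  proof (rule eq_matI)
    show "dim_row Q' = dim_row Q" "dim_col Q' = dim_col Q"
      using Q' Q unfolding is_cholesky_factor_def dim by auto
    fix i j assume "i < dim_row Q" "j < dim_col Q"
    then have ij: "i < n" "j < n"
      using Q by auto
    have "(\<Sum>k<n. Q' $$ (i, k) * Q' $$ (j, k)) = (\<Sum>k<n. Q $$ (i, k) * Q $$ (j, k))" if "i < n" "j < n" for i j
      using factor Q' times[of Q i j] times[of Q' i j] that unfolding is_cholesky_factor_def dim by auto
    with factor Q' show "Q' $$ (i, j) = Q $$ (i, j)"
      unfolding is_cholesky_factor_def dim
      by (intro cholesky_entries_unique[of n "\<lambda>i j. Q' $$ (i, j)" "\<lambda>i j. Q $$ (i, j)" i j] ij) auto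
  qed
  show ?thesis
    unfolding cholesky_factor_def by (rule theI[of "is_cholesky_factor G", OF factor unique])
qed

lemma cholesky_factor_inverse:
  assumes Q: "is_cholesky_factor G Q" and G: "G \<in> carrier_mat n n"
  shows "\<exists>R. mat_inverse Q = Some R \<and> R \<in> carrier_mat n n \<and> Q * R = 1\<^sub>m n \<and> R * Q = 1\<^sub>m n"
proof -
  have dim: "dim_row G = n"
    using G by auto
  have carrier: "Q \<in> carrier_mat n n"
    and low: "\<And>i j. i < j \<Longrightarrow> j < n \<Longrightarrow> Q $$ (i, j) = 0" and diag: "\<And>i. i < n \<Longrightarrow> 0 < Q $$ (i, i)"
    using Q unfolding is_cholesky_factor_def dim by auto
  have "0 \<notin> set (diag_mat Q)"
    using diag carrier by (force simp: diag_mat_def)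
  then have "det Q \<noteq> 0"
    using det_lower_triangular[OF low carrier] by (simp add: prod_list_zero_iff)
  then have "Q \<in> Units (ring_mat TYPE(real) n ())"
    by (rule det_non_zero_imp_unit[OF carrier])
  then obtain R where "mat_inverse Q = Some R"
    using mat_inverse(1)[OF carrier, of "()"] by (cases "mat_inverse Q") auto
  then show ?thesis
    using mat_inverse(2)[OF carrier] by auto
qed

section \<open>Orthonormal B-splines of one random variable\<close>

text \<open>
  Two properties of the distribution of \<open>Z\<close> carry the argument. The right end point has probability 0, so that
  the B-splines may be replaced by their recursive definition, which sums to 1 only on the half-open
  interval. Every subinterval has positive probability, so that no spline other than 0 vanishes almost
  surely.
\<close>

locale spline_variable = open_knot_sequence a b p \<xi> + prob_space M
  for a b :: real and p :: nat and \<xi> :: "real list" and M :: "'w measure" +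
  fixes Z :: "'w \<Rightarrow> real"
  assumes Z [measurable]: "Z \<in> borel_measurable M"
    and Z_range: "AE \<omega> in M. a \<le> Z \<omega> \<and> Z \<omega> < b"
    and Z_charges: "\<And>u v. a \<le> u \<Longrightarrow> u < v \<Longrightarrow> v \<le> b \<Longrightarrow> 0 < prob {\<omega> \<in> space M. u < Z \<omega> \<and> Z \<omega> < v}"
begin

definition aux :: "nat \<Rightarrow> real \<Rightarrow> real" where
  "aux i x = (if i = 0 then 1 else bspline \<xi> p (i + 1) x)"

lemma aux_basis_nth: "i < n \<Longrightarrow> vec_index (aux_basis p \<xi> x) i = aux i x"
  by (simp add: aux_basis_def aux_def)

lemma bspline_eq: "x < b \<Longrightarrow> bspline \<xi> p i x = bspline_rec \<xi> p i x"
  by (simp add: bspline_def last_knot)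

lemma borel_measurable_aux [measurable]: "aux i \<in> borel_measurable borel"
  unfolding aux_def[abs_def] by measurable

lemma aux_bounded: "AE \<omega> in M. \<bar>aux i (Z \<omega>)\<bar> \<le> 1" if "i < n"
  using Z_range
proof eventually_elim
  case (elim \<omega>)
  then show ?case
    using that bspline_rec_nonneg[OF sorted_knots, of "i + 1" p "Z \<omega>"] bspline_rec_le_1[of "Z \<omega>" "i + 1"] length_knots
    by (auto simp: aux_def bspline_eq)
qed

lemma integrable_aux_mult_aux: "integrable M (\<lambda>\<omega>. aux i (Z \<omega>) * aux j (Z \<omega>))" if "i < n" "j < n"
proof (rule integrable_const_bound[of _ 1])
  show "AE \<omega> in M. norm (aux i (Z \<omega>) * aux j (Z \<omega>)) \<le> 1"
    using aux_bounded[OF that(1)] aux_bounded[OF that(2)]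
    by eventually_elim (auto simp: abs_mult intro: mult_le_one)
qed measurable

abbreviation G :: "real mat" where "G \<equiv> gram_matrix M Z p \<xi>"

lemma gram_matrix_carrier: "G \<in> carrier_mat n n"
  by (simp add: gram_matrix_def)

lemma gram_matrix_nth: "i < n \<Longrightarrow> j < n \<Longrightarrow> G $$ (i, j) = (\<integral>\<omega>. aux i (Z \<omega>) * aux j (Z \<omega>) \<partial>M)"
  by (simp add: gram_matrix_def aux_basis_nth)

lemma gram_form:
  "(\<Sum>i<n. \<Sum>j<n. c i * d j * G $$ (i, j)) =
    (\<integral>\<omega>. (\<Sum>i<n. c i * aux i (Z \<omega>)) * (\<Sum>j<n. d j * aux j (Z \<omega>)) \<partial>M)"
proof -
  have "(\<integral>\<omega>. (\<Sum>i<n. c i * aux i (Z \<omega>)) * (\<Sum>j<n. d j * aux j (Z \<omega>)) \<partial>M) =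
      (\<integral>\<omega>. (\<Sum>i<n. \<Sum>j<n. (c i * d j) * (aux i (Z \<omega>) * aux j (Z \<omega>))) \<partial>M)"
    by (simp add: sum_product mult_ac)
  also have "\<dots> = (\<Sum>i<n. \<Sum>j<n. c i * d j * (\<integral>\<omega>. aux i (Z \<omega>) * aux j (Z \<omega>) \<partial>M))"
    by (subst Bochner_Integration.integral_sum,
        intro Bochner_Integration.integrable_sum integrable_mult_right integrable_aux_mult_aux, simp_all,
        intro sum.cong refl, subst Bochner_Integration.integral_sum) (simp_all add: integrable_aux_mult_aux)
  finally show ?thesis
    by (simp add: gram_matrix_nth)
qed

text \<open>
  The quadratic form of the Gram matrix is the second moment of a spline in \<open>Z\<close>. If it is not
  positive, the spline vanishes almost surely, hence somewhere in every interval to the right of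
  every point, and all of its coefficients are 0.
\<close>

lemma gram_matrix_positive_definite:
  assumes "\<exists>i<n. c i \<noteq> 0"
  shows "0 < (\<Sum>i<n. \<Sum>j<n. c i * c j * G $$ (i, j))"
proof (rule ccontr)
  define S where "S x = (\<Sum>i<n. c i * aux i x)" for x
  have [measurable]: "S \<in> borel_measurable borel"
    unfolding S_def[abs_def] by measurable
  have int: "integrable M (\<lambda>\<omega>. S (Z \<omega>) * S (Z \<omega>))"
  proof -
    have "integrable M (\<lambda>\<omega>. \<Sum>i<n. \<Sum>j<n. (c i * c j) * (aux i (Z \<omega>) * aux j (Z \<omega>)))"
      using integrable_aux_mult_aux by (intro Bochner_Integration.integrable_sum integrable_mult_right) auto
    then show ?thesis
      by (simp add: S_def sum_product mult_ac)
  qed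
  assume "\<not> ?thesis"
  moreover have "0 \<le> (\<integral>\<omega>. S (Z \<omega>) * S (Z \<omega>) \<partial>M)"
    by simp
  ultimately have "(\<integral>\<omega>. S (Z \<omega>) * S (Z \<omega>) \<partial>M) = 0"
    unfolding gram_form S_def[symmetric] by auto
  then have "AE \<omega> in M. S (Z \<omega>) * S (Z \<omega>) = 0"
    using integral_nonneg_eq_0_iff_AE[OF int] by auto
  then have S0: "AE \<omega> in M. S (Z \<omega>) = 0"
    by simp
  \<comment> \<open>The constant function is the sum of all B-splines, so \<open>d\<close> lists the coefficients of \<open>S\<close> in the
    B-spline basis.\<close>
  define d where "d i = (if i = 1 then c 0 else c 0 + c (i - 1))" for i
  have S_eq: "S x = (\<Sum>i=1..n. d i * bspline_rec \<xi> p i x)" if "a \<le> x" "x < b" for x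
  proof -
    obtain m where m: "n = Suc m"
      using degree_less_num_bsplines by (cases n) auto
    have "(\<Sum>i=1..n. d i * bspline_rec \<xi> p i x) = (\<Sum>i=1..n. c 0 * bspline_rec \<xi> p i x) +
        (\<Sum>i=1..n. (if i = 1 then 0 else c (i - 1)) * bspline_rec \<xi> p i x)"
      unfolding sum.distrib[symmetric] by (intro sum.cong) (auto simp: d_def algebra_simps)
    also have "(\<Sum>i=1..n. c 0 * bspline_rec \<xi> p i x) = c 0"
      using sum_bsplines_eq_1[OF that] by (simp flip: sum_distrib_left)
    also have "(\<Sum>i=1..n. (if i = 1 then 0 else c (i - 1)) * bspline_rec \<xi> p i x) =
        (\<Sum>i<n. (if i = 0 then 0 else c i) * bspline_rec \<xi> p (i + 1) x)"
      by (rule sum.reindex_bij_witness[of _ Suc "\<lambda>i. i - 1"]) auto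
    also have "\<dots> = (\<Sum>i<m. c (Suc i) * bspline_rec \<xi> p (Suc i + 1) x)"
      unfolding m by (simp add: sum.lessThan_Suc_shift del: sum.lessThan_Suc)
    also have "c 0 + \<dots> = S x"
      using that unfolding S_def m
      by (simp add: sum.lessThan_Suc_shift aux_def bspline_eq del: sum.lessThan_Suc)
    finally show ?thesis ..
  qed
  have "d i = 0" if "i \<in> {1..n}" for i
  proof (rule bsplines_independent[OF _ that])
    fix z assume z: "a \<le> z" "z < b"
    show "\<exists>\<^sub>F x in at_right z. (\<Sum>i=1..n. d i * bspline_rec \<xi> p i x) = 0"
    proof (rule ccontr)
      assume "\<not> ?thesis"
      then obtain v where v: "v > z" "\<And>x. z < x \<Longrightarrow> x < v \<Longrightarrow> (\<Sum>i=1..n. d i * bspline_rec \<xi> p i x) \<noteq> 0"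
        unfolding not_frequently eventually_at_right_field by auto
      let ?A = "{\<omega> \<in> space M. z < Z \<omega> \<and> Z \<omega> < min v b}"
      have "AE \<omega> in M. \<omega> \<notin> ?A"
        using S0
      proof eventually_elim
        case (elim \<omega>)
        then show ?case
          using v(2)[of "Z \<omega>"] S_eq[of "Z \<omega>"] z by auto
      qed
      then have "prob ?A = 0"
        by (intro prob_eq_0[THEN iffD2]) auto
      then show False
        using Z_charges[of z "min v b"] v(1) z by simp
    qed
  qed
  then have d0: "d (Suc i) = 0" if "i < n" for i
    using that by auto
  have "c i = 0" if "i < n" for i
    using d0[of 0] d0[of i] that by (cases i) (auto simp: d_def)
  then show False
    using assms by auto
qed

definition Q :: "real mat" where "Q = cholesky_factor G"
definition R :: "real mat" where "R = the (mat_inverse Q)"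
abbreviation \<psi> :: "nat \<Rightarrow> real \<Rightarrow> real" where "\<psi> \<equiv> orth_bspline M Z p \<xi>"

lemma is_cholesky_factor_Q: "is_cholesky_factor G Q"
  unfolding Q_def using gram_matrix_carrier gram_matrix_positive_definite
  by (intro is_cholesky_factor_cholesky_factor[of G n]) (auto simp: gram_matrix_nth mult.commute)

lemma Q_carrier: "Q \<in> carrier_mat n n"
  using is_cholesky_factor_Q gram_matrix_carrier unfolding is_cholesky_factor_def by auto

lemma R_inverse: "R \<in> carrier_mat n n" "Q * R = 1\<^sub>m n" "R * Q = 1\<^sub>m n"
  using cholesky_factor_inverse[OF is_cholesky_factor_Q gram_matrix_carrier] unfolding R_def by auto

lemma orth_bspline_eq: "\<psi> (Suc i) x = (\<Sum>j<n. R $$ (i, j) * aux j x)" if "i < n"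
proof -
  have "\<psi> (Suc i) x = scalar_prod (row R i) (aux_basis p \<xi> x)"
    using that R_inverse(1) unfolding orth_bspline_def R_def[symmetric] Q_def[symmetric] by simp
  also have "\<dots> = (\<Sum>j<n. R $$ (i, j) * aux j x)"
    using that R_inverse(1) by (auto simp: scalar_prod_def aux_basis_def aux_def lessThan_atLeast0 intro!: sum.cong)
  finally show ?thesis .
qed

lemma matrix_product_nth:
  "A \<in> carrier_mat n n \<Longrightarrow> B \<in> carrier_mat n n \<Longrightarrow> i < n \<Longrightarrow> j < n \<Longrightarrow>
    (A * B) $$ (i, j) = (\<Sum>k<n. A $$ (i, k) * B $$ (k, j))"
  by (auto simp: scalar_prod_def lessThan_atLeast0 intro!: sum.cong)

lemma aux_eq: "aux i x = (\<Sum>j<n. Q $$ (i, j) * \<psi> (Suc j) x)" if "i < n"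
proof -
  have "(\<Sum>j<n. Q $$ (i, j) * \<psi> (Suc j) x) = (\<Sum>j<n. \<Sum>k<n. Q $$ (i, j) * R $$ (j, k) * aux k x)"
    by (simp add: orth_bspline_eq sum_distrib_left mult.assoc)
  also have "\<dots> = (\<Sum>k<n. (Q * R) $$ (i, k) * aux k x)"
    using that by (subst sum.swap) (simp add: matrix_product_nth Q_carrier R_inverse(1) sum_distrib_right del: R_inverse(2))
  also have "\<dots> = (\<Sum>k<n. if k = i then aux i x else 0)"
    using that by (intro sum.cong) (auto simp: R_inverse(2))
  finally show ?thesis
    using that by simp
qed

text \<open>
  Only the first B-spline is missing from the auxiliary basis; it is 1 minus all the others.
\<close>

lemma bspline_in_span: "\<exists>\<alpha>. \<forall>x. a \<le> x \<and> x < b \<longrightarrow> bspline_rec \<xi> p i x = (\<Sum>j=1..n. \<alpha> j * \<psi> j x)"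
  if "1 \<le> i" "i \<le> n"
proof -
  \<comment> \<open>The coefficients of B-spline \<open>i\<close> in the auxiliary basis.\<close>
  define \<gamma> where "\<gamma> k = (if i = 1 then (if k = 0 then 1 else -1) else if k = i - 1 then 1 else 0 :: real)" for k
  have \<gamma>: "bspline_rec \<xi> p i x = (\<Sum>k<n. \<gamma> k * aux k x)" if x: "a \<le> x" "x < b" for x
  proof (cases "i = 1")
    case True
    obtain m where m: "n = Suc m"
      using degree_less_num_bsplines by (cases n) auto
    have "1 = (\<Sum>i=1..n. bspline_rec \<xi> p i x)"
      using sum_bsplines_eq_1[OF x] ..
    also have "\<dots> = (\<Sum>i<n. bspline_rec \<xi> p (i + 1) x)"
      by (rule sum.reindex_bij_witness[of _ Suc "\<lambda>i. i - 1"]) auto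
    finally show ?thesis
      using x unfolding m True
      by (simp add: sum.lessThan_Suc_shift aux_def bspline_eq \<gamma>_def True sum_negf del: sum.lessThan_Suc)
  next
    case False
    have "(\<Sum>k<n. \<gamma> k * aux k x) = (\<Sum>k<n. if k = i - 1 then aux k x else 0)"
      using False by (intro sum.cong) (auto simp: \<gamma>_def)
    also have "\<dots> = aux (i - 1) x"
      using that \<open>i \<le> n\<close> \<open>1 \<le> i\<close> by simp
    finally show ?thesis
      using False \<open>1 \<le> i\<close> x by (simp add: aux_def bspline_eq)
  qed
  have "bspline_rec \<xi> p i x = (\<Sum>j=1..n. (\<Sum>k<n. \<gamma> k * Q $$ (k, j - 1)) * \<psi> j x)" if x: "a \<le> x" "x < b" for x
  proof -
    have "bspline_rec \<xi> p i x = (\<Sum>k<n. \<Sum>j<n. \<gamma> k * (Q $$ (k, j) * \<psi> (Suc j) x))"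
      using \<gamma>[OF x] by (simp add: aux_eq sum_distrib_left)
    also have "\<dots> = (\<Sum>j<n. (\<Sum>k<n. \<gamma> k * Q $$ (k, j)) * \<psi> (Suc j) x)"
      by (subst sum.swap) (simp add: sum_distrib_right mult.assoc)
    also have "\<dots> = (\<Sum>j=1..n. (\<Sum>k<n. \<gamma> k * Q $$ (k, j - 1)) * \<psi> j x)"
      by (rule sum.reindex_bij_witness[of _ "\<lambda>i. i - 1" Suc]) auto
    finally show ?thesis .
  qed
  then show ?thesis
    by (intro exI[of _ "\<lambda>j. \<Sum>k<n. \<gamma> k * Q $$ (k, j - 1)"]) auto
qed

lemma borel_measurable_orth_bspline: "\<psi> i \<in> borel_measurable borel" if "1 \<le> i" "i \<le> n"
proof -
  have "\<psi> i = (\<lambda>x. \<Sum>j<n. R $$ (i - 1, j) * aux j x)"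
    using orth_bspline_eq[of "i - 1"] that by auto
  then show ?thesis
    by simp
qed

lemma orth_bspline_bounded: "\<exists>C. AE \<omega> in M. \<bar>\<psi> i (Z \<omega>)\<bar> \<le> C" if "1 \<le> i" "i \<le> n"
proof (intro exI)
  have "AE \<omega> in M. \<forall>j\<in>{..<n}. \<bar>aux j (Z \<omega>)\<bar> \<le> 1"
    using aux_bounded by (intro AE_finite_allI) auto
  then show "AE \<omega> in M. \<bar>\<psi> i (Z \<omega>)\<bar> \<le> (\<Sum>j<n. \<bar>R $$ (i - 1, j)\<bar>)"
  proof eventually_elim
    case (elim \<omega>)
    have "\<bar>\<psi> i (Z \<omega>)\<bar> \<le> (\<Sum>j<n. \<bar>R $$ (i - 1, j) * aux j (Z \<omega>)\<bar>)"
      using orth_bspline_eq[of "i - 1"] that by auto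
    also have "\<dots> \<le> (\<Sum>j<n. \<bar>R $$ (i - 1, j)\<bar>)"
      using elim by (intro sum_mono) (auto simp: abs_mult intro!: mult_left_le)
    finally show ?case .
  qed
qed

text \<open>
  With the inverse \<open>R\<close> of \<open>Q\<close>, the second moments form the matrix \<open>R G R\<^sup>T = (R Q) (R Q)\<^sup>T = 1\<close>.
\<close>

lemma orth_bspline_orthonormal:
  assumes "1 \<le> i" "i \<le> n" "1 \<le> j" "j \<le> n"
  shows "(\<integral>\<omega>. \<psi> i (Z \<omega>) * \<psi> j (Z \<omega>) \<partial>M) = (if i = j then 1 else 0)"
proof -
  obtain i' j' where ij: "i = Suc i'" "i' < n" "j = Suc j'" "j' < n"
    using assms by (cases i; cases j) auto
  have Gnth: "G $$ (k, l) = (\<Sum>m<n. Q $$ (k, m) * Q $$ (l, m))" if "k < n" "l < n" for k l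
  proof -
    have "G $$ (k, l) = (Q * transpose_mat Q) $$ (k, l)"
      using is_cholesky_factor_Q unfolding is_cholesky_factor_def by simp
    also have "\<dots> = (\<Sum>m<n. Q $$ (k, m) * Q $$ (l, m))"
      using that Q_carrier by (subst matrix_product_nth) (auto intro!: sum.cong)
    finally show ?thesis .
  qed
  have "(\<integral>\<omega>. \<psi> i (Z \<omega>) * \<psi> j (Z \<omega>) \<partial>M) = (\<Sum>k<n. \<Sum>l<n. R $$ (i', k) * R $$ (j', l) * G $$ (k, l))"
    unfolding gram_form using ij by (simp add: orth_bspline_eq)
  also have "\<dots> = (\<Sum>k<n. \<Sum>l<n. \<Sum>m<n. (R $$ (i', k) * Q $$ (k, m)) * (R $$ (j', l) * Q $$ (l, m)))"
    by (intro sum.cong refl) (simp add: Gnth sum_distrib_left mult_ac)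
  also have "\<dots> = (\<Sum>k<n. \<Sum>m<n. \<Sum>l<n. (R $$ (i', k) * Q $$ (k, m)) * (R $$ (j', l) * Q $$ (l, m)))"
    by (intro sum.cong refl sum.swap)
  also have "\<dots> = (\<Sum>m<n. \<Sum>k<n. \<Sum>l<n. (R $$ (i', k) * Q $$ (k, m)) * (R $$ (j', l) * Q $$ (l, m)))"
    by (rule sum.swap)
  also have "\<dots> = (\<Sum>m<n. (R * Q) $$ (i', m) * (R * Q) $$ (j', m))"
    using ij by (intro sum.cong refl) (simp add: matrix_product_nth Q_carrier R_inverse(1) sum_product)
  also have "\<dots> = (\<Sum>m<n. if m = i' then (if i' = j' then 1 else 0) else 0)"
    using ij by (intro sum.cong) (auto simp: R_inverse(3))
  also have "\<dots> = (if i = j then 1 else 0)"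
    using ij by simp
  finally show ?thesis .
qed

end

section \<open>Orthogonal projection in mean square\<close>

definition square_integrable :: "'a measure \<Rightarrow> ('a \<Rightarrow> real) \<Rightarrow> bool" where
  "square_integrable M f \<longleftrightarrow> f \<in> borel_measurable M \<and> integrable M (\<lambda>x. (f x)\<^sup>2)"

lemma square_integrableD [dest]:
  assumes "square_integrable M f"
  shows "f \<in> borel_measurable M" "integrable M (\<lambda>x. (f x)\<^sup>2)"
  using assms by (auto simp: square_integrable_def)

lemma square_integrable_mult_integrable:
  assumes "square_integrable M f" "square_integrable M g"
  shows "integrable M (\<lambda>x. f x * g x)"
proof (rule Bochner_Integration.integrable_bound)
  show "integrable M (\<lambda>x. (f x)\<^sup>2 + (g x)\<^sup>2)"
    using assms by auto
  show "(\<lambda>x. f x * g x) \<in> borel_measurable M"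
    using assms by (auto intro!: borel_measurable_times)
  have "\<bar>u * v\<bar> \<le> u\<^sup>2 + v\<^sup>2" for u v :: real
    using sum_squares_bound[of "\<bar>u\<bar>" "\<bar>v\<bar>"] abs_ge_zero[of "u * v"] unfolding abs_mult power2_abs by linarith
  then show "AE x in M. norm (f x * g x) \<le> norm ((f x)\<^sup>2 + (g x)\<^sup>2)"
    by auto
qed

lemma square_integrable_cmult:
  assumes "square_integrable M f"
  shows "square_integrable M (\<lambda>x. c * f x)"
  using assms by (auto simp: square_integrable_def power_mult_distrib)

lemma square_integrable_add:
  assumes "square_integrable M f" "square_integrable M g"
  shows "square_integrable M (\<lambda>x. f x + g x)"
  unfolding square_integrable_def
proof
  show "(\<lambda>x. f x + g x) \<in> borel_measurable M"
    using assms by (auto intro!: borel_measurable_add)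
  have "integrable M (\<lambda>x. (f x)\<^sup>2 + (g x)\<^sup>2 + 2 * (f x * g x))"
    using square_integrable_mult_integrable[OF assms] assms[THEN square_integrableD(2)]
    by (intro Bochner_Integration.integrable_add integrable_mult_right)
  then show "integrable M (\<lambda>x. (f x + g x)\<^sup>2)"
    by (simp add: power2_sum mult.assoc)
qed

lemma square_integrable_diff:
  assumes "square_integrable M f" "square_integrable M g"
  shows "square_integrable M (\<lambda>x. f x - g x)"
  using square_integrable_add[OF assms(1) square_integrable_cmult[OF assms(2), of "-1"]] by simp

lemma square_integrable_sum:
  assumes "\<And>i. i \<in> I \<Longrightarrow> square_integrable M (f i)"
  shows "square_integrable M (\<lambda>x. \<Sum>i\<in>I. f i x)"
  using assms
proof (induction I rule: infinite_finite_induct)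
  case (insert i I)
  then show ?case
    using square_integrable_add[of M "f i" "\<lambda>x. \<Sum>i\<in>I. f i x"] by simp
qed (auto simp: square_integrable_def)

lemma (in finite_measure) square_integrable_AE_bounded:
  assumes "f \<in> borel_measurable M" "AE x in M. \<bar>f x\<bar> \<le> C"
  shows "square_integrable M f"
  unfolding square_integrable_def
proof
  show "integrable M (\<lambda>x. (f x)\<^sup>2)"
  proof (rule integrable_const_bound[of _ "C\<^sup>2"])
    show "AE x in M. norm ((f x)\<^sup>2) \<le> C\<^sup>2"
      using assms(2)
    proof eventually_elim
      case (elim x)
      then show ?case
        using power_mono[OF elim, of 2] by simp
    qed
  qed (use assms in auto)
qed fact

lemma integral_square_diff_triangle:
  assumes "square_integrable M f" "square_integrable M g" "square_integrable M h"
  shows "(\<integral>x. (f x - h x)\<^sup>2 \<partial>M) \<le> 2 * (\<integral>x. (f x - g x)\<^sup>2 \<partial>M) + 2 * (\<integral>x. (g x - h x)\<^sup>2 \<partial>M)"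
proof -
  have int: "integrable M (\<lambda>x. (f x - g x)\<^sup>2)" "integrable M (\<lambda>x. (g x - h x)\<^sup>2)" "integrable M (\<lambda>x. (f x - h x)\<^sup>2)"
    by (intro square_integrableD square_integrable_diff assms)+
  have tri: "(u - w)\<^sup>2 \<le> 2 * (u - v)\<^sup>2 + 2 * (v - w)\<^sup>2" for u v w :: real
    using zero_le_power2[of "(u - v) - (v - w)"] by (simp add: power2_eq_square algebra_simps)
  have "(\<integral>x. (f x - h x)\<^sup>2 \<partial>M) \<le> (\<integral>x. 2 * (f x - g x)\<^sup>2 + 2 * (g x - h x)\<^sup>2 \<partial>M)"
    by (rule integral_mono[OF int(3)])
      (intro Bochner_Integration.integrable_add integrable_mult_right int(1) int(2), rule tri)
  then show ?thesis
    using int by simp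
qed

text \<open>
  Expanding the square, the error with coefficients \<open>d\<close> exceeds the error with the Fourier coefficients
  \<open>c\<close> by the sum of the \<open>(d i - c i)\<^sup>2\<close>.
\<close>

lemma orthonormal_best_approximation:
  assumes "finite I" and \<Psi>: "\<And>i. i \<in> I \<Longrightarrow> square_integrable M (\<Psi> i)" and y: "square_integrable M y"
    and orth: "\<And>i j. i \<in> I \<Longrightarrow> j \<in> I \<Longrightarrow> (\<integral>x. \<Psi> i x * \<Psi> j x \<partial>M) = (if i = j then 1 else 0)"
  shows "(\<integral>x. (y x - (\<Sum>i\<in>I. (\<integral>x. y x * \<Psi> i x \<partial>M) * \<Psi> i x))\<^sup>2 \<partial>M) \<le> (\<integral>x. (y x - (\<Sum>i\<in>I. d i * \<Psi> i x))\<^sup>2 \<partial>M)"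
proof -
  define c where "c i = (\<integral>x. y x * \<Psi> i x \<partial>M)" for i
  have expand: "(\<integral>x. (y x - (\<Sum>i\<in>I. d i * \<Psi> i x))\<^sup>2 \<partial>M) =
      (\<integral>x. (y x)\<^sup>2 \<partial>M) - 2 * (\<Sum>i\<in>I. d i * c i) + (\<Sum>i\<in>I. d i * d i)" for d
  proof -
    define u where "u x = (\<Sum>i\<in>I. d i * \<Psi> i x)" for x
    have u: "square_integrable M u"
      unfolding u_def[abs_def] by (intro square_integrable_sum square_integrable_cmult \<Psi>)
    have int: "integrable M (\<lambda>x. (y x)\<^sup>2)" "integrable M (\<lambda>x. y x * u x)" "integrable M (\<lambda>x. u x * u x)"
      using y u by (auto intro: square_integrable_mult_integrable)
    have "(\<integral>x. (y x - u x)\<^sup>2 \<partial>M) = (\<integral>x. (y x)\<^sup>2 - 2 * (y x * u x) + u x * u x \<partial>M)"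
      by (simp add: power2_eq_square algebra_simps)
    also have "\<dots> = (\<integral>x. (y x)\<^sup>2 \<partial>M) - 2 * (\<integral>x. y x * u x \<partial>M) + (\<integral>x. u x * u x \<partial>M)"
      using int by simp
    also have "(\<integral>x. y x * u x \<partial>M) = (\<integral>x. (\<Sum>i\<in>I. d i * (y x * \<Psi> i x)) \<partial>M)"
      by (simp add: u_def sum_distrib_left mult_ac)
    also have "\<dots> = (\<Sum>i\<in>I. d i * c i)"
      using square_integrable_mult_integrable[OF y \<Psi>] by (simp add: c_def)
    also have "(\<integral>x. u x * u x \<partial>M) = (\<integral>x. (\<Sum>i\<in>I. d i * (u x * \<Psi> i x)) \<partial>M)"
      by (simp add: u_def[of _] sum_distrib_left mult_ac)
    also have "\<dots> = (\<Sum>i\<in>I. d i * (\<integral>x. u x * \<Psi> i x \<partial>M))"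
      using square_integrable_mult_integrable[OF u \<Psi>] by simp
    also have "\<dots> = (\<Sum>i\<in>I. d i * d i)"
    proof (intro sum.cong refl arg_cong2[where f = "(*)"])
      fix i assume i: "i \<in> I"
      have "(\<integral>x. u x * \<Psi> i x \<partial>M) = (\<integral>x. (\<Sum>j\<in>I. d j * (\<Psi> j x * \<Psi> i x)) \<partial>M)"
        unfolding u_def sum_distrib_right by (simp add: mult.assoc)
      also have "\<dots> = (\<Sum>j\<in>I. d j * (\<integral>x. \<Psi> j x * \<Psi> i x \<partial>M))"
        using square_integrable_mult_integrable[OF \<Psi> \<Psi>] i by simp
      also have "\<dots> = (\<Sum>j\<in>I. if j = i then d i else 0)"
        using i by (intro sum.cong) (auto simp: orth)
      finally show "(\<integral>x. u x * \<Psi> i x \<partial>M) = d i"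
        using i \<open>finite I\<close> by simp
    qed
    finally show ?thesis
      unfolding u_def .
  qed
  have "0 \<le> (\<Sum>i\<in>I. (d i - c i)\<^sup>2)"
    by (intro sum_nonneg) auto
  also have "\<dots> = (\<Sum>i\<in>I. d i * d i) - 2 * (\<Sum>i\<in>I. d i * c i) + (\<Sum>i\<in>I. c i * c i)"
    unfolding sum_distrib_left sum_subtractf[symmetric] sum.distrib[symmetric]
    by (intro sum.cong) (auto simp: power2_eq_square algebra_simps)
  finally show ?thesis
    unfolding c_def[symmetric] expand by simp
qed

section \<open>Density of the continuous functions in mean square\<close>

text \<open>
  The approximating functions are required to be continuous on the whole space rather than on the
  support of the measure; they are then Borel functions for every Borel measure, and sums and
  multiples of them are again of this kind.
\<close>

definition L2_approximable :: "'a::metric_space measure \<Rightarrow> ('a \<Rightarrow> real) \<Rightarrow> bool" where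
  "L2_approximable N f \<longleftrightarrow> square_integrable N f \<and>
     (\<forall>e>0. \<exists>g. continuous_on UNIV g \<and> square_integrable N g \<and> (\<integral>x. (f x - g x)\<^sup>2 \<partial>N) < e)"

lemma L2_approximable_closed:
  assumes f: "square_integrable N f"
    and ex: "\<And>e. e > 0 \<Longrightarrow> \<exists>h. L2_approximable N h \<and> (\<integral>x. (f x - h x)\<^sup>2 \<partial>N) < e"
  shows "L2_approximable N f"
  unfolding L2_approximable_def
proof (intro conjI allI impI f)
  fix e :: real assume "e > 0"
  then obtain h where h: "L2_approximable N h" "(\<integral>x. (f x - h x)\<^sup>2 \<partial>N) < e / 4"
    using ex[of "e / 4"] by auto
  obtain g where g: "continuous_on UNIV g" "square_integrable N g" "(\<integral>x. (h x - g x)\<^sup>2 \<partial>N) < e / 4"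
    using h(1) \<open>e > 0\<close> unfolding L2_approximable_def by (meson divide_pos_pos zero_less_numeral)
  have "square_integrable N h"
    using h by (simp add: L2_approximable_def)
  then have "(\<integral>x. (f x - g x)\<^sup>2 \<partial>N) \<le> 2 * (\<integral>x. (f x - h x)\<^sup>2 \<partial>N) + 2 * (\<integral>x. (h x - g x)\<^sup>2 \<partial>N)"
    by (intro integral_square_diff_triangle f g)
  then show "\<exists>g. continuous_on UNIV g \<and> square_integrable N g \<and> (\<integral>x. (f x - g x)\<^sup>2 \<partial>N) < e"
    using h g by (intro exI[of _ g]) auto
qed

lemma L2_approximable_limit:
  assumes f: "square_integrable N f" and U: "\<And>i. L2_approximable N (U i)"
    and lim: "\<And>x. x \<in> space N \<Longrightarrow> (\<lambda>i. U i x) \<longlonglongrightarrow> f x"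
    and w: "integrable N w" "\<And>i x. x \<in> space N \<Longrightarrow> (f x - U i x)\<^sup>2 \<le> w x"
  shows "L2_approximable N f"
proof (rule L2_approximable_closed[OF f])
  have meas: "f \<in> borel_measurable N" "\<And>i. U i \<in> borel_measurable N"
    using f U by (auto simp: L2_approximable_def)
  have "(\<lambda>i. \<integral>x. (f x - U i x)\<^sup>2 \<partial>N) \<longlonglongrightarrow> (\<integral>x. 0 \<partial>N)"
  proof (rule integral_dominated_convergence[OF _ _ w(1)])
    show "AE x in N. (\<lambda>i. (f x - U i x)\<^sup>2) \<longlonglongrightarrow> 0"
    proof (rule AE_I2)
      fix x assume "x \<in> space N"
      then have "(\<lambda>i. (f x - U i x)\<^sup>2) \<longlonglongrightarrow> (f x - f x)\<^sup>2"
        by (intro tendsto_intros lim)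
      then show "(\<lambda>i. (f x - U i x)\<^sup>2) \<longlonglongrightarrow> 0"
        by simp
    qed
  qed (use meas w in auto)
  then have lim0: "(\<lambda>i. \<integral>x. (f x - U i x)\<^sup>2 \<partial>N) \<longlonglongrightarrow> 0"
    by simp
  fix e :: real assume "e > 0"
  then have "eventually (\<lambda>i. (\<integral>x. (f x - U i x)\<^sup>2 \<partial>N) < e) sequentially"
    using order_tendstoD(2)[OF lim0] by auto
  then show "\<exists>h. L2_approximable N h \<and> (\<integral>x. (f x - h x)\<^sup>2 \<partial>N) < e"
    using U by (auto simp: eventually_sequentially)
qed

lemma L2_approximable_continuous:
  assumes "continuous_on UNIV f" "square_integrable N f"
  shows "L2_approximable N f"
  unfolding L2_approximable_def using assms by (auto intro!: exI[of _ f])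

lemma L2_approximable_cmult:
  assumes "L2_approximable N f"
  shows "L2_approximable N (\<lambda>x. c * f x)"
proof (cases "c = 0")
  case True
  then show ?thesis
    by (auto intro!: L2_approximable_continuous simp: square_integrable_def)
next
  case False
  show ?thesis
    unfolding L2_approximable_def
  proof (intro conjI allI impI)
    show "square_integrable N (\<lambda>x. c * f x)"
      using assms by (auto simp: L2_approximable_def intro: square_integrable_cmult)
    fix e :: real assume "e > 0"
    then have "e / c\<^sup>2 > 0"
      using False by simp
    then obtain g where g: "continuous_on UNIV g" "square_integrable N g" "(\<integral>x. (f x - g x)\<^sup>2 \<partial>N) < e / c\<^sup>2"
      using assms unfolding L2_approximable_def by blast
    have "(\<integral>x. (c * f x - c * g x)\<^sup>2 \<partial>N) = c\<^sup>2 * (\<integral>x. (f x - g x)\<^sup>2 \<partial>N)"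
      by (simp add: right_diff_distrib[symmetric] power_mult_distrib)
    also have "\<dots> < e"
      using g(3) False by (simp add: field_simps)
    finally show "\<exists>g. continuous_on UNIV g \<and> square_integrable N g \<and> (\<integral>x. (c * f x - g x)\<^sup>2 \<partial>N) < e"
      using g by (intro exI[of _ "\<lambda>x. c * g x"]) (auto intro: square_integrable_cmult continuous_intros)
  qed
qed

lemma L2_approximable_add:
  assumes "L2_approximable N f" "L2_approximable N g"
  shows "L2_approximable N (\<lambda>x. f x + g x)"
  unfolding L2_approximable_def
proof (intro conjI allI impI)
  have sq: "square_integrable N f" "square_integrable N g"
    using assms by (auto simp: L2_approximable_def)
  show "square_integrable N (\<lambda>x. f x + g x)"
    by (intro square_integrable_add sq)
  fix e :: real assume e: "e > 0"
  obtain f' where f': "continuous_on UNIV f'" "square_integrable N f'" "(\<integral>x. (f x - f' x)\<^sup>2 \<partial>N) < e / 4"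
    using assms(1) e unfolding L2_approximable_def by (meson divide_pos_pos zero_less_numeral)
  obtain g' where g': "continuous_on UNIV g'" "square_integrable N g'" "(\<integral>x. (g x - g' x)\<^sup>2 \<partial>N) < e / 4"
    using assms(2) e unfolding L2_approximable_def by (meson divide_pos_pos zero_less_numeral)
  have "(\<integral>x. ((f x + g x) - (f' x + g' x))\<^sup>2 \<partial>N) \<le>
      2 * (\<integral>x. ((f x + g x) - (f' x + g x))\<^sup>2 \<partial>N) + 2 * (\<integral>x. ((f' x + g x) - (f' x + g' x))\<^sup>2 \<partial>N)"
    by (intro integral_square_diff_triangle square_integrable_add sq f' g')
  then show "\<exists>h. continuous_on UNIV h \<and> square_integrable N h \<and> (\<integral>x. ((f x + g x) - h x)\<^sup>2 \<partial>N) < e"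
    using f' g' by (intro exI[of _ "\<lambda>x. f' x + g' x"]) (auto intro!: square_integrable_add continuous_intros)
qed

text \<open>
  The indicator of a closed set is the pointwise limit of the ramps that fall from 1 to 0 within
  distance \<open>1 / i\<close> of the set.
\<close>

lemma L2_approximable_indicator_closed:
  assumes "finite_measure N" "sets N = sets borel" "closed K"
  shows "L2_approximable N (indicator K)"
\<comment> \<open>The distance to the empty set is 0 by convention, so the ramps do not approximate its indicator.\<close>
proof (cases "K = {}")
  case True
  then show ?thesis
    by (auto intro!: L2_approximable_continuous simp: square_integrable_def)
next
  case False
  interpret finite_measure N by fact
  have meas: "f \<in> borel_measurable N \<longleftrightarrow> f \<in> borel_measurable borel" for f :: "'a \<Rightarrow> real"
    using measurable_cong_sets[OF assms(2) refl] by auto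
  have K: "K \<in> sets N"
    using assms by auto
  define U :: "nat \<Rightarrow> 'a \<Rightarrow> real" where "U i x = max 0 (1 - real i * infdist x K)" for i x
  have cont: "continuous_on UNIV (U i)" for i
    unfolding U_def[abs_def] by (intro continuous_intros)
  have U01: "U i x \<in> {0..1}" for i x
    using infdist_nonneg[of x K] by (auto simp: U_def)
  show ?thesis
  proof (rule L2_approximable_limit)
    show "square_integrable N (indicator K)"
      using K by (intro square_integrable_AE_bounded[of _ 1]) (auto simp: indicator_def)
    show "L2_approximable N (U i)" for i
      using cont U01[of i]
      by (intro L2_approximable_continuous square_integrable_AE_bounded[of _ 1])
        (auto simp: meas intro: borel_measurable_continuous_onI)
    show "(\<lambda>i. U i x) \<longlonglongrightarrow> indicator K x" for x
    proof (cases "x \<in> K")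
      case True
      then show ?thesis
        by (simp add: U_def)
    next
      case False
      then have pos: "infdist x K > 0"
        using in_closed_iff_infdist_zero[OF \<open>closed K\<close> \<open>K \<noteq> {}\<close>, of x] infdist_nonneg[of x K] by auto
      have "eventually (\<lambda>i. U i x = 0) sequentially"
        using eventually_ge_at_top[of "nat \<lceil>1 / infdist x K\<rceil>"]
      proof eventually_elim
        case (elim i)
        then have "1 / infdist x K \<le> real i"
          by linarith
        then show ?case
          using pos by (simp add: U_def field_simps)
      qed
      then show ?thesis
        using False by (auto intro: tendsto_eventually)
    qed
    show "(indicator K x - U i x)\<^sup>2 \<le> 1" for i x
      using U01[of i x] by (intro abs_square_le_1[THEN iffD2]) (auto simp: indicator_def)
  qed auto
qed

text \<open>
  Finite Borel measures on Polish spaces are inner regular, which reduces a Borel set to a compact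
  subset of almost the same measure.
\<close>

lemma L2_approximable_indicator:
  fixes N :: "'a::{second_countable_topology, complete_space} measure"
  assumes "finite_measure N" "sets N = sets borel" "A \<in> sets N"
  shows "L2_approximable N (indicator A)"
proof (rule L2_approximable_closed)
  interpret finite_measure N by fact
  show "square_integrable N (indicator A)"
    using assms by (intro square_integrable_AE_bounded[of _ 1]) (auto simp: indicator_def)
  fix e :: real assume e: "e > 0"
  show "\<exists>h. L2_approximable N h \<and> (\<integral>x. (indicator A x - h x)\<^sup>2 \<partial>N) < e"
  proof (cases "measure N A = 0")
    case True
    have "(\<integral>x. (indicator A x - 0)\<^sup>2 \<partial>N) = measure N A"
      using assms by (simp add: power2_eq_square flip: indicator_inter_arith)
    then show ?thesis
      using True e by (intro exI[of _ "\<lambda>_. 0"]) (auto intro!: L2_approximable_continuous simp: square_integrable_def)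
  next
    case False
    have "emeasure N A = (SUP K \<in> {K. K \<subseteq> A \<and> compact K}. emeasure N K)"
      using assms by (intro inner_regular) auto
    moreover have "ennreal (measure N A - e) < emeasure N A"
      using e False unfolding emeasure_eq_measure by (intro ennreal_lessI) (auto simp: zero_less_measure_iff)
    ultimately obtain K where K: "K \<subseteq> A" "compact K" "ennreal (measure N A - e) < emeasure N K"
      by (auto simp: less_SUP_iff)
    have Ks: "K \<in> sets N"
      using K assms by (auto intro: borel_compact)
    have "measure N A - e < measure N K"
      using K(3) unfolding emeasure_eq_measure
      by (meson ennreal_leI leD leI)
    then have "measure N (A - K) < e"
      using finite_measure_Diff[OF assms(3) Ks K(1)] by simp
    moreover have "(\<integral>x. (indicator A x - indicator K x :: real)\<^sup>2 \<partial>N) = (\<integral>x. indicator (A - K) x \<partial>N)"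
      using K(1) by (intro Bochner_Integration.integral_cong) (auto simp: indicator_def)
    ultimately show ?thesis
      using K assms Ks by (intro exI[of _ "indicator K"])
        (auto intro!: L2_approximable_indicator_closed compact_imp_closed)
  qed
qed

lemma square_integrable_dominated:
  assumes "square_integrable M g" "f \<in> borel_measurable M" "\<And>x. x \<in> space M \<Longrightarrow> \<bar>f x\<bar> \<le> \<bar>g x\<bar>"
  shows "square_integrable M f"
  unfolding square_integrable_def
proof
  show "integrable M (\<lambda>x. (f x)\<^sup>2)"
  proof (rule Bochner_Integration.integrable_bound)
    show "AE x in M. norm ((f x)\<^sup>2) \<le> norm ((g x)\<^sup>2)"
      using assms(3) by (auto intro!: AE_I2 simp: abs_le_square_iff)
  qed (use assms in auto)
qed fact

text \<open>
  The approximable functions contain the indicators and are closed under linear combinations and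
  dominated limits; so they contain all nonnegative square-integrable functions and their
  differences.
\<close>

theorem continuous_functions_dense_in_L2:
  fixes N :: "'a::{second_countable_topology, complete_space} measure"
  assumes "finite_measure N" "sets N = sets borel" "square_integrable N f"
  shows "L2_approximable N f"
proof -
  have nonneg: "square_integrable N f \<longrightarrow> L2_approximable N f"
    if "f \<in> borel_measurable N" "\<And>x. 0 \<le> f x" for f
    using that
  proof (induction f rule: borel_measurable_induct_real)
    case (set A)
    then show ?case
      using L2_approximable_indicator assms by auto
  next
    case (mult u c)
    show ?case
    proof (cases "c = 0")
      case True
      then show ?thesis
        by (auto intro!: L2_approximable_continuous)
    next
      case False
      show ?thesis
      proof
        assume "square_integrable N (\<lambda>x. c * u x)"
        then have "square_integrable N (\<lambda>x. (1 / c) * (c * u x))"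
          by (rule square_integrable_cmult)
        then show "L2_approximable N (\<lambda>x. c * u x)"
          using mult False by (intro L2_approximable_cmult) auto
      qed
    qed
  next
    case (add u v)
    show ?case
    proof
      assume *: "square_integrable N (\<lambda>x. v x + u x)"
      have "square_integrable N u" "square_integrable N v"
        using add by (auto intro!: square_integrable_dominated[OF *])
      then show "L2_approximable N (\<lambda>x. v x + u x)"
        using add by (intro L2_approximable_add) auto
    qed
  next
    case (seq U)
    show ?case
    proof
      assume f: "square_integrable N f"
      have le: "U i x \<le> f x" if "x \<in> space N" for i x
        using seq that by (intro incseq_le) (auto simp: incseq_def le_fun_def)
      show "L2_approximable N f"
      proof (rule L2_approximable_limit[OF f])
        have "square_integrable N (U i)" for i
          using seq le by (intro square_integrable_dominated[OF f]) (auto intro: order_trans[OF le abs_ge_self])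
        then show "L2_approximable N (U i)" for i
          using seq by blast
        show "integrable N (\<lambda>x. (f x)\<^sup>2)"
          using f by auto
        show "(f x - U i x)\<^sup>2 \<le> (f x)\<^sup>2" if "x \<in> space N" for i x
          using le[OF that, of i] seq(2)[of i x] by (intro power_mono) auto
        show "(\<lambda>i. U i x) \<longlonglongrightarrow> f x" if "x \<in> space N" for x
          using seq that by blast
      qed
    qed
  qed
  have meas: "f \<in> borel_measurable N"
    using assms by auto
  have "L2_approximable N (\<lambda>x. max 0 (f x))" "L2_approximable N (\<lambda>x. max 0 (- f x))"
    using meas by (intro nonneg[THEN mp] square_integrable_dominated[OF assms(3)]; force)+
  from L2_approximable_add[OF this(1) L2_approximable_cmult[OF this(2), of "-1"]]
  have "L2_approximable N (\<lambda>x. max 0 (f x) + (- 1) * max 0 (- f x))" .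
  moreover have "(\<lambda>x. max 0 (f x) + (- 1) * max 0 (- f x)) = f"
    by (auto simp: fun_eq_iff max_def)
  ultimately show ?thesis
    by simp
qed

section \<open>Tensor-product splines of a random vector\<close>

locale spline_vector = prob_space M for M :: "'w measure" +
  fixes X :: "'w \<Rightarrow> real ^ 'n" and a b :: "real ^ 'n" and p :: "'n \<Rightarrow> nat" and \<Xi> :: "'n \<Rightarrow> real list"
  assumes indep: "indep_vars (\<lambda>_. borel) (\<lambda>k \<omega>. X \<omega> $ k) UNIV"
    and components: "\<And>k. spline_variable (a $ k) (b $ k) (p k) (\<Xi> k) M (\<lambda>\<omega>. X \<omega> $ k)"
begin

abbreviation I :: "('n \<Rightarrow> nat) set" where "I \<equiv> multi_indices p \<Xi>"
abbreviation \<Psi> :: "('n \<Rightarrow> nat) \<Rightarrow> real ^ 'n \<Rightarrow> real" where "\<Psi> \<equiv> mv_orth_bspline M X p \<Xi>"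
abbreviation \<psi> :: "'n \<Rightarrow> nat \<Rightarrow> real \<Rightarrow> real" where
  "\<psi> k \<equiv> orth_bspline M (\<lambda>\<omega>. X \<omega> $ k) (p k) (\<Xi> k)"

lemma open_knot_sequence_components: "open_knot_sequence (a $ k) (b $ k) (p k) (\<Xi> k)"
  using components[of k] by (simp add: spline_variable_def)

lemma multi_indices_eq_PiE: "I = PiE UNIV (\<lambda>k. {1..num_bsplines (p k) (\<Xi> k)})"
  by (auto simp: multi_indices_def)

lemma finite_multi_indices: "finite I"
  unfolding multi_indices_eq_PiE by (intro finite_PiE) auto

lemma multi_indicesD: "i \<in> I \<Longrightarrow> 1 \<le> i k" "i \<in> I \<Longrightarrow> i k \<le> num_bsplines (p k) (\<Xi> k)"
  by (auto simp: multi_indices_def)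

lemma X_component_measurable: "(\<lambda>\<omega>. X \<omega> $ k) \<in> borel_measurable M"
  by (rule spline_variable.Z[OF components])

lemma X_range: "AE \<omega> in M. \<forall>k. a $ k \<le> X \<omega> $ k \<and> X \<omega> $ k < b $ k"
proof -
  have "AE \<omega> in M. \<forall>k\<in>UNIV. a $ k \<le> X \<omega> $ k \<and> X \<omega> $ k < b $ k"
    using spline_variable.Z_range[OF components] by (intro AE_finite_allI) auto
  then show ?thesis
    by simp
qed

lemma square_integrable_mv_orth_bspline: "square_integrable M (\<lambda>\<omega>. \<Psi> i (X \<omega>))" if i: "i \<in> I"
proof -
  have "\<exists>C. AE \<omega> in M. \<bar>\<psi> k (i k) (X \<omega> $ k)\<bar> \<le> C" for k
    using spline_variable.orth_bspline_bounded[OF components] multi_indicesD[OF i] by auto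
  then obtain C where C: "\<And>k. AE \<omega> in M. \<bar>\<psi> k (i k) (X \<omega> $ k)\<bar> \<le> C k"
    by metis
  show ?thesis
  proof (rule square_integrable_AE_bounded[of _ "\<Prod>k\<in>UNIV. C k"])
    have "(\<lambda>\<omega>. \<psi> k (i k) (X \<omega> $ k)) \<in> borel_measurable M" for k
      using spline_variable.borel_measurable_orth_bspline[OF components] multi_indicesD[OF i]
      by (intro measurable_compose[OF X_component_measurable]) auto
    then show "(\<lambda>\<omega>. \<Psi> i (X \<omega>)) \<in> borel_measurable M"
      unfolding mv_orth_bspline_def by (intro borel_measurable_prod)
    have "AE \<omega> in M. \<forall>k\<in>UNIV. \<bar>\<psi> k (i k) (X \<omega> $ k)\<bar> \<le> C k"
      using C by (intro AE_finite_allI) auto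
    then show "AE \<omega> in M. \<bar>\<Psi> i (X \<omega>)\<bar> \<le> (\<Prod>k\<in>UNIV. C k)"
      by eventually_elim (auto simp: mv_orth_bspline_def abs_prod intro!: prod_mono)
  qed
qed

text \<open>
  By independence of the coordinates the second moment of two products is the product of the
  univariate second moments.
\<close>

lemma mv_orth_bspline_orthonormal:
  assumes i: "i \<in> I" and j: "j \<in> I"
  shows "(\<integral>\<omega>. \<Psi> i (X \<omega>) * \<Psi> j (X \<omega>) \<partial>M) = (if i = j then 1 else 0)"
proof -
  define Y where "Y k \<omega> = \<psi> k (i k) (X \<omega> $ k) * \<psi> k (j k) (X \<omega> $ k)" for k \<omega>
  have meas: "(\<lambda>x. \<psi> k (i k) x * \<psi> k (j k) x) \<in> borel_measurable borel" for k
    using spline_variable.borel_measurable_orth_bspline[OF components] multi_indicesD[OF i] multi_indicesD[OF j]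
    by (intro borel_measurable_times) auto
  have sq: "square_integrable M (\<lambda>\<omega>. \<psi> k (i k) (X \<omega> $ k))" if i: "i \<in> I" for i k
  proof -
    obtain C where "AE \<omega> in M. \<bar>\<psi> k (i k) (X \<omega> $ k)\<bar> \<le> C"
      using spline_variable.orth_bspline_bounded[OF components] multi_indicesD[OF i] by metis
    then show ?thesis
      using spline_variable.borel_measurable_orth_bspline[OF components] multi_indicesD[OF i]
      by (intro square_integrable_AE_bounded measurable_compose[OF X_component_measurable]) auto
  qed
  have int: "integrable M (Y k)" for k
    unfolding Y_def[abs_def] by (intro square_integrable_mult_integrable sq i j)
  have ind: "indep_vars (\<lambda>_. borel) Y UNIV"
    unfolding Y_def[abs_def]
    using indep_vars_compose2[OF indep, of "\<lambda>k x. \<psi> k (i k) x * \<psi> k (j k) x" "\<lambda>_. borel"] meas by simp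
  have "(\<integral>\<omega>. \<Psi> i (X \<omega>) * \<Psi> j (X \<omega>) \<partial>M) = (\<integral>\<omega>. (\<Prod>k\<in>UNIV. Y k \<omega>) \<partial>M)"
    by (simp add: mv_orth_bspline_def Y_def prod.distrib)
  also have "\<dots> = (\<Prod>k\<in>UNIV. \<integral>\<omega>. Y k \<omega> \<partial>M)"
    by (rule indep_vars_lebesgue_integral[OF _ ind int]) auto
  also have "\<dots> = (\<Prod>k\<in>UNIV. if i k = j k then 1 else 0)"
    unfolding Y_def
    using spline_variable.orth_bspline_orthonormal[OF components] multi_indicesD[OF i] multi_indicesD[OF j]
    by (intro prod.cong) auto
  also have "\<dots> = (if i = j then 1 else 0)"
    by (auto simp: fun_eq_iff)
  finally show ?thesis .
qed

lemma sce_best_approximation: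
  assumes "square_integrable M (\<lambda>\<omega>. y (X \<omega>))"
  shows "(\<integral>\<omega>. (y (X \<omega>) - sce M X p \<Xi> y (X \<omega>))\<^sup>2 \<partial>M) \<le> (\<integral>\<omega>. (y (X \<omega>) - (\<Sum>i\<in>I. d i * \<Psi> i (X \<omega>)))\<^sup>2 \<partial>M)"
  unfolding sce_def sce_coeff_def
  by (intro orthonormal_best_approximation finite_multi_indices square_integrable_mv_orth_bspline
      mv_orth_bspline_orthonormal assms)

lemma square_integrable_sce: "square_integrable M (\<lambda>\<omega>. sce M X p \<Xi> y (X \<omega>))"
  unfolding sce_def by (intro square_integrable_sum square_integrable_cmult square_integrable_mv_orth_bspline)

text \<open>
  The recursive B-splines serve here in place of those with left limits at the right end points: the
  two differ only on the faces \<open>x\<^sub>k = b\<^sub>k\<close>, which have probability 0.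
\<close>

definition tensor_bspline :: "('n \<Rightarrow> nat) \<Rightarrow> real ^ 'n \<Rightarrow> real" where
  "tensor_bspline i x = (\<Prod>k\<in>UNIV. bspline_rec (\<Xi> k) (p k) (i k) (x $ k))"

text \<open>
  Any point of the support of a tensor-product B-spline would do as its node; its lower corner is at
  hand.
\<close>

definition node :: "('n \<Rightarrow> nat) \<Rightarrow> real ^ 'n" where
  "node i = (\<chi> k. knot (\<Xi> k) (i k))"

definition quasi_interpolant :: "(real ^ 'n \<Rightarrow> real) \<Rightarrow> real ^ 'n \<Rightarrow> real" where
  "quasi_interpolant g x = (\<Sum>i\<in>I. g (node i) * tensor_bspline i x)"

lemma node_in_cbox:
  assumes i: "i \<in> I"
  shows "node i \<in> cbox a b"
proof -
  have "knot (\<Xi> k) (i k) \<in> {a $ k..b $ k}" for k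
    using multi_indicesD[OF i, of k] open_knot_sequence.length_knots[OF open_knot_sequence_components, of k]
    by (intro open_knot_sequence.knots_in_interval[OF open_knot_sequence_components]) auto
  then show ?thesis
    by (auto simp: mem_box_cart node_def)
qed

lemma tensor_bspline_nonneg: "i \<in> I \<Longrightarrow> 0 \<le> tensor_bspline i x"
  unfolding tensor_bspline_def
  using open_knot_sequence.sorted_knots[OF open_knot_sequence_components]
    open_knot_sequence.length_knots[OF open_knot_sequence_components] multi_indicesD[of i]
  by (intro prod_nonneg) (auto intro!: bspline_rec_nonneg)

lemma sum_tensor_bsplines:
  assumes "\<And>k. a $ k \<le> x $ k \<and> x $ k < b $ k"
  shows "(\<Sum>i\<in>I. tensor_bspline i x) = 1"
proof -
  have "(\<Sum>i\<in>I. tensor_bspline i x) = (\<Prod>k\<in>UNIV. \<Sum>i=1..num_bsplines (p k) (\<Xi> k). bspline_rec (\<Xi> k) (p k) i (x $ k))"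
    unfolding multi_indices_eq_PiE tensor_bspline_def by (rule prod_sum_PiE[symmetric]) auto
  also have "\<dots> = 1"
    using open_knot_sequence.sum_bsplines_eq_1[OF open_knot_sequence_components] assms
    by (intro prod.neutral) auto
  finally show ?thesis .
qed

text \<open>
  Each univariate B-spline is a combination of the orthonormal ones, and multiplying out the product
  of these sums gives a combination of the products. The coefficients do not depend on the point,
  which is what the comparison with the projection requires.
\<close>

lemma quasi_interpolant_in_span:
  "\<exists>d. \<forall>x. (\<forall>k. a $ k \<le> x $ k \<and> x $ k < b $ k) \<longrightarrow> quasi_interpolant g x = (\<Sum>j\<in>I. d j * \<Psi> j x)"
proof -
  define \<alpha> where "\<alpha> k i = (SOME \<alpha>. \<forall>x. a $ k \<le> x \<and> x < b $ k \<longrightarrow>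
      bspline_rec (\<Xi> k) (p k) i x = (\<Sum>j=1..num_bsplines (p k) (\<Xi> k). \<alpha> j * \<psi> k j x))" for k i
  have \<alpha>: "bspline_rec (\<Xi> k) (p k) i x = (\<Sum>j=1..num_bsplines (p k) (\<Xi> k). \<alpha> k i j * \<psi> k j x)"
    if "1 \<le> i" "i \<le> num_bsplines (p k) (\<Xi> k)" "a $ k \<le> x" "x < b $ k" for k i x
    using someI_ex[OF spline_variable.bspline_in_span[OF components that(1,2)]] that(3,4)
    unfolding \<alpha>_def by blast
  define d where "d j = (\<Sum>i\<in>I. g (node i) * (\<Prod>k\<in>UNIV. \<alpha> k (i k) (j k)))" for j
  have "quasi_interpolant g x = (\<Sum>j\<in>I. d j * \<Psi> j x)" if x: "\<And>k. a $ k \<le> x $ k \<and> x $ k < b $ k" for x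
  proof -
    have tensor: "tensor_bspline i x = (\<Sum>j\<in>I. (\<Prod>k\<in>UNIV. \<alpha> k (i k) (j k)) * \<Psi> j x)" if "i \<in> I" for i
    proof -
      have "tensor_bspline i x = (\<Prod>k\<in>UNIV. \<Sum>j=1..num_bsplines (p k) (\<Xi> k). \<alpha> k (i k) j * \<psi> k j (x $ k))"
        unfolding tensor_bspline_def using \<alpha> multi_indicesD[OF that] x by (intro prod.cong) auto
      also have "\<dots> = (\<Sum>j\<in>I. \<Prod>k\<in>UNIV. \<alpha> k (i k) (j k) * \<psi> k (j k) (x $ k))"
        unfolding multi_indices_eq_PiE by (rule prod_sum_PiE) auto
      finally show ?thesis
        by (simp add: prod.distrib mv_orth_bspline_def)
    qed
    have "quasi_interpolant g x = (\<Sum>i\<in>I. \<Sum>j\<in>I. g (node i) * (\<Prod>k\<in>UNIV. \<alpha> k (i k) (j k)) * \<Psi> j x)"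
      unfolding quasi_interpolant_def by (intro sum.cong) (auto simp: tensor sum_distrib_left mult.assoc)
    also have "\<dots> = (\<Sum>j\<in>I. d j * \<Psi> j x)"
      by (subst sum.swap) (simp add: d_def sum_distrib_right)
    finally show ?thesis .
  qed
  then show ?thesis
    by blast
qed

text \<open>
  The error is a mean of the differences \<open>g x - g (node i)\<close> with weights \<open>tensor_bspline i x\<close>, and a
  weight is nonzero only if \<open>x\<close> is near the node.
\<close>

lemma quasi_interpolant_error:
  assumes x: "\<And>k. a $ k \<le> x $ k \<and> x $ k < b $ k"
    and osc: "\<And>z. z \<in> cbox a b \<Longrightarrow> (\<And>k. \<bar>x $ k - z $ k\<bar> \<le> real (p k + 1) * mesh_size (\<Xi> k)) \<Longrightarrow> \<bar>g x - g z\<bar> \<le> e"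
  shows "\<bar>g x - quasi_interpolant g x\<bar> \<le> e"
proof -
  have "g x - quasi_interpolant g x = (\<Sum>i\<in>I. (g x - g (node i)) * tensor_bspline i x)"
    using sum_tensor_bsplines[OF x]
    by (simp add: quasi_interpolant_def left_diff_distrib sum_subtractf flip: sum_distrib_left)
  also have "\<bar>\<dots>\<bar> \<le> (\<Sum>i\<in>I. e * tensor_bspline i x)"
  proof (rule order_trans[OF sum_abs sum_mono])
    fix i assume i: "i \<in> I"
    show "\<bar>(g x - g (node i)) * tensor_bspline i x\<bar> \<le> e * tensor_bspline i x"
    proof (cases "tensor_bspline i x = 0")
      case False
      then have "bspline_rec (\<Xi> k) (p k) (i k) (x $ k) \<noteq> 0" for k
        by (simp add: tensor_bspline_def)
      then have "\<bar>x $ k - node i $ k\<bar> \<le> real (p k + 1) * mesh_size (\<Xi> k)" for k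
        using open_knot_sequence.bspline_support_width[OF open_knot_sequence_components] multi_indicesD[OF i]
        unfolding node_def by auto
      then have "\<bar>g x - g (node i)\<bar> \<le> e"
        by (intro osc node_in_cbox i)
      then show ?thesis
        using tensor_bspline_nonneg[OF i, of x] by (auto simp: abs_mult intro: mult_right_mono)
    qed simp
  qed
  also have "\<dots> = e"
    using sum_tensor_bsplines[OF x] by (simp flip: sum_distrib_left)
  finally show ?thesis .
qed

text \<open>
  The expansion is at least as good as the quasi-interpolant of \<open>g\<close>, which differs from \<open>g\<close> by at
  most the oscillation of \<open>g\<close> over the supports. The factors 2 come from \<open>(u + v)\<^sup>2 \<le> 2 u\<^sup>2 + 2 v\<^sup>2\<close>.
\<close>

lemma sce_error_bound:
  assumes y: "square_integrable M (\<lambda>\<omega>. y (X \<omega>))" and g: "square_integrable M (\<lambda>\<omega>. g (X \<omega>))"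
    and osc: "\<And>x z. x \<in> cbox a b \<Longrightarrow> z \<in> cbox a b \<Longrightarrow>
      (\<And>k. \<bar>x $ k - z $ k\<bar> \<le> real (p k + 1) * mesh_size (\<Xi> k)) \<Longrightarrow> \<bar>g x - g z\<bar> \<le> e"
  shows "(\<integral>\<omega>. (y (X \<omega>) - sce M X p \<Xi> y (X \<omega>))\<^sup>2 \<partial>M) \<le> 2 * (\<integral>\<omega>. (y (X \<omega>) - g (X \<omega>))\<^sup>2 \<partial>M) + 2 * e\<^sup>2"
proof -
  obtain d where d: "\<And>x. (\<And>k. a $ k \<le> x $ k \<and> x $ k < b $ k) \<Longrightarrow> quasi_interpolant g x = (\<Sum>j\<in>I. d j * \<Psi> j x)"
    using quasi_interpolant_in_span[of g] by blast
  define u where "u \<omega> = (\<Sum>j\<in>I. d j * \<Psi> j (X \<omega>))" for \<omega>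
  have u: "square_integrable M u"
    unfolding u_def[abs_def] by (intro square_integrable_sum square_integrable_cmult square_integrable_mv_orth_bspline)
  have err: "AE \<omega> in M. (g (X \<omega>) - u \<omega>)\<^sup>2 \<le> e\<^sup>2"
    using X_range
  proof eventually_elim
    case (elim \<omega>)
    then have "X \<omega> \<in> cbox a b"
      by (auto simp: mem_box_cart less_imp_le)
    then have "\<bar>g (X \<omega>) - quasi_interpolant g (X \<omega>)\<bar> \<le> e"
      using elim by (intro quasi_interpolant_error osc) auto
    then have "\<bar>g (X \<omega>) - u \<omega>\<bar> \<le> e"
      using d[of "X \<omega>"] elim by (simp add: u_def)
    then show ?case
      using power_mono[of "\<bar>g (X \<omega>) - u \<omega>\<bar>" e 2] by simp
  qed
  have "(\<integral>\<omega>. (y (X \<omega>) - sce M X p \<Xi> y (X \<omega>))\<^sup>2 \<partial>M) \<le> (\<integral>\<omega>. (y (X \<omega>) - u \<omega>)\<^sup>2 \<partial>M)"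
    unfolding u_def by (rule sce_best_approximation[OF y])
  also have "\<dots> \<le> 2 * (\<integral>\<omega>. (y (X \<omega>) - g (X \<omega>))\<^sup>2 \<partial>M) + 2 * (\<integral>\<omega>. (g (X \<omega>) - u \<omega>)\<^sup>2 \<partial>M)"
    by (rule integral_square_diff_triangle[OF y g u])
  also have "(\<integral>\<omega>. (g (X \<omega>) - u \<omega>)\<^sup>2 \<partial>M) \<le> (\<integral>\<omega>. e\<^sup>2 \<partial>M)"
    using square_integrable_diff[OF g u] err by (intro integral_mono_AE) auto
  finally show ?thesis
    by (simp add: prob_space)
qed

end

section \<open>Modes of convergence\<close>

context prob_space
begin

lemma mean_square_imp_in_probability:
  fixes Y :: "'a \<Rightarrow> real" and Ys :: "nat \<Rightarrow> 'a \<Rightarrow> real"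
  assumes Y: "square_integrable M Y" "\<And>s. square_integrable M (Ys s)"
    and lim: "(\<lambda>s. \<integral>\<omega>. (Y \<omega> - Ys s \<omega>)\<^sup>2 \<partial>M) \<longlonglongrightarrow> 0"
    and "\<epsilon> > 0"
  shows "(\<lambda>s. prob {\<omega> \<in> space M. \<bar>Y \<omega> - Ys s \<omega>\<bar> > \<epsilon>}) \<longlonglongrightarrow> 0"
proof (rule tendsto_sandwich[of "\<lambda>_. 0"])
  show "eventually (\<lambda>s. prob {\<omega> \<in> space M. \<bar>Y \<omega> - Ys s \<omega>\<bar> > \<epsilon>} \<le> (\<integral>\<omega>. (Y \<omega> - Ys s \<omega>)\<^sup>2 \<partial>M) / \<epsilon>\<^sup>2) sequentially"
  proof (intro always_eventually allI)
    fix s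
    have sq: "square_integrable M (\<lambda>\<omega>. Y \<omega> - Ys s \<omega>)"
      by (intro square_integrable_diff Y)
    note [measurable] = square_integrableD(1)[OF sq]
    have "\<epsilon>\<^sup>2 \<le> (Y \<omega> - Ys s \<omega>)\<^sup>2" if "\<bar>Y \<omega> - Ys s \<omega>\<bar> > \<epsilon>" for \<omega>
      using power_mono[of \<epsilon> "\<bar>Y \<omega> - Ys s \<omega>\<bar>" 2] that \<open>\<epsilon> > 0\<close> by simp
    then have "prob {\<omega> \<in> space M. \<bar>Y \<omega> - Ys s \<omega>\<bar> > \<epsilon>} \<le> prob {\<omega> \<in> space M. \<epsilon>\<^sup>2 \<le> (Y \<omega> - Ys s \<omega>)\<^sup>2}"
      by (intro finite_measure_mono) auto
    also have "\<dots> \<le> (\<integral>\<omega>. (Y \<omega> - Ys s \<omega>)\<^sup>2 \<partial>M) / \<epsilon>\<^sup>2"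
      using sq \<open>\<epsilon> > 0\<close> by (intro integral_Markov_inequality_measure[where A = "{}"]) auto
    finally show "prob {\<omega> \<in> space M. \<bar>Y \<omega> - Ys s \<omega>\<bar> > \<epsilon>} \<le> (\<integral>\<omega>. (Y \<omega> - Ys s \<omega>)\<^sup>2 \<partial>M) / \<epsilon>\<^sup>2" .
  qed
  show "(\<lambda>s. (\<integral>\<omega>. (Y \<omega> - Ys s \<omega>)\<^sup>2 \<partial>M) / \<epsilon>\<^sup>2) \<longlonglongrightarrow> 0"
    using tendsto_divide[OF lim tendsto_const[of "\<epsilon>\<^sup>2"]] \<open>\<epsilon> > 0\<close> by simp
qed auto

lemma distribution_function_shift_bound:
  fixes U V :: "'a \<Rightarrow> real"
  assumes [measurable]: "U \<in> borel_measurable M" "V \<in> borel_measurable M"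
  shows "prob {\<omega> \<in> space M. U \<omega> \<le> t} \<le>
    prob {\<omega> \<in> space M. V \<omega> \<le> t + \<delta>} + prob {\<omega> \<in> space M. \<bar>V \<omega> - U \<omega>\<bar> > \<delta>}"
proof -
  have "prob {\<omega> \<in> space M. U \<omega> \<le> t} \<le>
      prob ({\<omega> \<in> space M. V \<omega> \<le> t + \<delta>} \<union> {\<omega> \<in> space M. \<bar>V \<omega> - U \<omega>\<bar> > \<delta>})"
    by (intro finite_measure_mono) auto
  also have "\<dots> \<le> prob {\<omega> \<in> space M. V \<omega> \<le> t + \<delta>} + prob {\<omega> \<in> space M. \<bar>V \<omega> - U \<omega>\<bar> > \<delta>}"
    by (intro measure_Un_le) auto
  finally show ?thesis .
qed

text \<open>
  This bound serves both pointwise and uniform convergence: the first two assumptions on the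
  distribution function of \<open>Y\<close> express continuity at \<open>t\<close>, and \<open>\<delta>\<close> may or may not depend on \<open>t\<close>.
\<close>

lemma distribution_function_distance_bound:
  fixes Y W :: "'a \<Rightarrow> real"
  assumes [measurable]: "Y \<in> borel_measurable M" "W \<in> borel_measurable M"
    and "\<bar>prob {\<omega> \<in> space M. Y \<omega> \<le> t + \<delta>} - prob {\<omega> \<in> space M. Y \<omega> \<le> t}\<bar> < e"
    and "\<bar>prob {\<omega> \<in> space M. Y \<omega> \<le> t - \<delta>} - prob {\<omega> \<in> space M. Y \<omega> \<le> t}\<bar> < e"
    and "prob {\<omega> \<in> space M. \<bar>Y \<omega> - W \<omega>\<bar> > \<delta>} < e"
  shows "\<bar>prob {\<omega> \<in> space M. W \<omega> \<le> t} - prob {\<omega> \<in> space M. Y \<omega> \<le> t}\<bar> < 2 * e"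
  using distribution_function_shift_bound[of W Y t \<delta>] distribution_function_shift_bound[of Y W "t - \<delta>" \<delta>] assms(3-5)
  by (auto simp: abs_minus_commute)

lemma in_probability_imp_in_distribution:
  fixes Y :: "'a \<Rightarrow> real" and Ys :: "nat \<Rightarrow> 'a \<Rightarrow> real"
  assumes [measurable]: "Y \<in> borel_measurable M" "\<And>s. Ys s \<in> borel_measurable M"
    and lim: "\<And>\<epsilon>. \<epsilon> > 0 \<Longrightarrow> (\<lambda>s. prob {\<omega> \<in> space M. \<bar>Y \<omega> - Ys s \<omega>\<bar> > \<epsilon>}) \<longlonglongrightarrow> 0"
    and cont: "isCont (\<lambda>t. prob {\<omega> \<in> space M. Y \<omega> \<le> t}) t"
  shows "(\<lambda>s. prob {\<omega> \<in> space M. Ys s \<omega> \<le> t}) \<longlonglongrightarrow> prob {\<omega> \<in> space M. Y \<omega> \<le> t}"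
proof (rule tendstoI)
  fix e :: real assume e: "e > 0"
  then obtain d where d: "d > 0" "\<And>u. \<bar>u - t\<bar> < d \<Longrightarrow>
      \<bar>prob {\<omega> \<in> space M. Y \<omega> \<le> u} - prob {\<omega> \<in> space M. Y \<omega> \<le> t}\<bar> < e / 2"
    using cont[unfolded continuous_at_eps_delta dist_real_def, rule_format, of "e / 2"] by auto
  have "eventually (\<lambda>s. prob {\<omega> \<in> space M. \<bar>Y \<omega> - Ys s \<omega>\<bar> > d / 2} < e / 2) sequentially"
    using order_tendstoD(2)[OF lim[of "d / 2"], of "e / 2"] d e by auto
  then show "eventually (\<lambda>s. dist (prob {\<omega> \<in> space M. Ys s \<omega> \<le> t}) (prob {\<omega> \<in> space M. Y \<omega> \<le> t}) < e) sequentially"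
  proof eventually_elim
    case (elim s)
    then show ?case
      using distribution_function_distance_bound[of Y "Ys s" t "d / 2" "e / 2"] d(2)[of "t + d / 2"] d(2)[of "t - d / 2"] d(1)
      by (auto simp: dist_real_def)
  qed
qed

text \<open>
  Outside a compact interval the distribution function differs by less than \<open>e\<close> from its limits 0 and 1,
  and on a compact interval continuity is uniform.
\<close>

lemma continuous_distribution_function_uniformly_continuous:
  fixes Y :: "'a \<Rightarrow> real"
  assumes Y [measurable]: "Y \<in> borel_measurable M"
    and cont: "continuous_on UNIV (\<lambda>t. prob {\<omega> \<in> space M. Y \<omega> \<le> t})"
  shows "uniformly_continuous_on UNIV (\<lambda>t. prob {\<omega> \<in> space M. Y \<omega> \<le> t})"
proof -
  define F where "F t = prob {\<omega> \<in> space M. Y \<omega> \<le> t}" for t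
  interpret D: real_distribution "distr M borel Y"
    by (rule real_distribution_distr) simp
  have F_cdf: "cdf (distr M borel Y) = F"
    by (auto simp: F_def[abs_def] cdf_def[abs_def] fun_eq_iff measure_distr vimage_def Int_def conj_commute)
  have bot: "(F \<longlongrightarrow> 0) at_bot" and top: "(F \<longlongrightarrow> 1) at_top"
    using D.cdf_lim_at_bot D.cdf_lim_at_top_prob unfolding F_cdf by auto
  have mono: "F s \<le> F t" if "s \<le> t" for s t
    unfolding F_def using that by (intro finite_measure_mono) auto
  have F01: "0 \<le> F t" "F t \<le> 1" for t
    by (auto simp: F_def)
  have "uniformly_continuous_on UNIV F"
    unfolding uniformly_continuous_on_def
  proof (intro allI impI)
    fix e :: real assume e: "e > 0"
    obtain A where A: "F A < e"
      using order_tendstoD(2)[OF bot e] unfolding eventually_at_bot_linorder by auto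
    obtain B where B: "1 - e < F B"
      using order_tendstoD(1)[OF top, of "1 - e"] e unfolding eventually_at_top_linorder by auto
    \<comment> \<open>Enlarging the interval by 1 on both sides ensures that points at distance less than 1 lie both
      in it or on the same side, below \<open>A\<close> or above \<open>B\<close>.\<close>
    have uc: "uniformly_continuous_on {A - 1..B + 1} F"
      using cont unfolding F_def[symmetric]
      by (intro compact_uniformly_continuous) (auto intro: continuous_on_subset)
    obtain d where d: "d > 0" "\<And>s t. s \<in> {A - 1..B + 1} \<Longrightarrow> t \<in> {A - 1..B + 1} \<Longrightarrow> dist t s < d \<Longrightarrow> dist (F t) (F s) < e"
      by (rule uniformly_continuous_onE[OF uc e]) blast
    have "\<bar>F t - F s\<bar> < e" if "\<bar>t - s\<bar> < min d 1" for s t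
    proof -
      have st: "\<bar>t - s\<bar> < 1"
        using that by simp
      consider "s \<in> {A - 1..B + 1}" "t \<in> {A - 1..B + 1}" | "s \<le> A" "t \<le> A" | "B \<le> s" "B \<le> t"
      proof -
        have "(A - 1 \<le> s \<and> A - 1 \<le> t \<and> s \<le> B + 1 \<and> t \<le> B + 1) \<or> (s \<le> A \<and> t \<le> A) \<or> (B \<le> s \<and> B \<le> t)"
          using st unfolding abs_less_iff by arith
        then show thesis
          using that by auto
      qed
      then show ?thesis
      proof cases
        case 1
        then show ?thesis
          using d(2)[of s t] that by (auto simp: dist_real_def)
      next
        case 2
        then show ?thesis
          using mono[of s A] mono[of t A] F01[of s] F01[of t] A by auto
      next
        case 3
        then show ?thesis
          using mono[of B s] mono[of B t] F01[of s] F01[of t] B by auto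
      qed
    qed
    then show "\<exists>d>0. \<forall>s\<in>UNIV. \<forall>t\<in>UNIV. dist t s < d \<longrightarrow> dist (F t) (F s) < e"
      using d(1) by (intro exI[of _ "min d 1"]) (auto simp: dist_real_def)
  qed
  then show ?thesis
    unfolding F_def[abs_def] .
qed

lemma in_probability_imp_uniform_distribution:
  fixes Y :: "'a \<Rightarrow> real" and Ys :: "nat \<Rightarrow> 'a \<Rightarrow> real"
  assumes [measurable]: "Y \<in> borel_measurable M" "\<And>s. Ys s \<in> borel_measurable M"
    and lim: "\<And>\<epsilon>. \<epsilon> > 0 \<Longrightarrow> (\<lambda>s. prob {\<omega> \<in> space M. \<bar>Y \<omega> - Ys s \<omega>\<bar> > \<epsilon>}) \<longlonglongrightarrow> 0"
    and cont: "continuous_on UNIV (\<lambda>t. prob {\<omega> \<in> space M. Y \<omega> \<le> t})"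
  shows "uniform_limit UNIV (\<lambda>s t. prob {\<omega> \<in> space M. Ys s \<omega> \<le> t}) (\<lambda>t. prob {\<omega> \<in> space M. Y \<omega> \<le> t}) sequentially"
proof (rule uniform_limitI)
  fix e :: real assume e: "e > 0"
  then obtain d where d: "d > 0" "\<And>u t. \<bar>u - t\<bar> < d \<Longrightarrow>
      \<bar>prob {\<omega> \<in> space M. Y \<omega> \<le> u} - prob {\<omega> \<in> space M. Y \<omega> \<le> t}\<bar> < e / 2"
    using continuous_distribution_function_uniformly_continuous[OF assms(1) cont,
        unfolded uniformly_continuous_on_def dist_real_def, rule_format, of "e / 2"] by auto
  have "eventually (\<lambda>s. prob {\<omega> \<in> space M. \<bar>Y \<omega> - Ys s \<omega>\<bar> > d / 2} < e / 2) sequentially"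
    using order_tendstoD(2)[OF lim[of "d / 2"], of "e / 2"] d e by auto
  then show "\<forall>\<^sub>F s in sequentially. \<forall>t\<in>UNIV. dist (prob {\<omega> \<in> space M. Ys s \<omega> \<le> t}) (prob {\<omega> \<in> space M. Y \<omega> \<le> t}) < e"
  proof eventually_elim
    case (elim s)
    then show ?case
      using distribution_function_distance_bound[of Y "Ys s" _ "d / 2" "e / 2"] d(2)[of "t + d / 2" t for t] d(2)[of "t - d / 2" t for t] d(1)
      by (auto simp: dist_real_def)
  qed
qed

end

section \<open>Convergence of the spline expansion\<close>

text \<open>
  The set where the density is positive is dense in \<open>[a, b]\<close> and relatively open by continuity. So it
  meets every subinterval in a nonempty open set, which has positive Lebesgue measure.
\<close>

lemma spline_variable_of_density:
  assumes M: "prob_space M" and knots: "open_knot_sequence a b p \<xi>"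
    and range: "\<And>\<omega>. \<omega> \<in> space M \<Longrightarrow> Z \<omega> \<in> {a..b}"
    and f: "distributed M lborel Z (\<lambda>x. ennreal (f x))" "continuous_on {a..b} f"
    and supp: "closure {x. 0 < f x} = {a..b}"
  shows "spline_variable a b p \<xi> M Z"
proof -
  interpret prob_space M by fact
  interpret open_knot_sequence a b p \<xi> by fact
  have Z [measurable]: "Z \<in> borel_measurable M"
    using distributed_measurable[OF f(1)] by simp
  show ?thesis
  proof
    have "AE x in lborel. 0 < ennreal (f x) \<longrightarrow> x \<noteq> b"
      using AE_lborel_singleton[of b] by eventually_elim auto
    then have "AE \<omega> in M. Z \<omega> \<noteq> b"
      using distributed_AE2[OF f(1), of "\<lambda>x. x \<noteq> b"] by auto
    then show "AE \<omega> in M. a \<le> Z \<omega> \<and> Z \<omega> < b"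
      using AE_space by eventually_elim (use range in \<open>force simp: less_le\<close>)
    fix u v assume uv: "a \<le> u" "u < v" "v \<le> b"
    show "0 < prob {\<omega> \<in> space M. u < Z \<omega> \<and> Z \<omega> < v}"
    proof (rule ccontr)
      assume "\<not> ?thesis"
      then have "prob {\<omega> \<in> space M. u < Z \<omega> \<and> Z \<omega> < v} = 0"
        by (simp add: not_less measure_le_0_iff)
      then have "AE \<omega> in M. \<not> (u < Z \<omega> \<and> Z \<omega> < v)"
        by (subst (asm) prob_eq_0) (auto elim!: AE_mp)
      then have ae: "AE x in lborel. 0 < f x \<longrightarrow> \<not> (u < x \<and> x < v)"
        using distributed_AE2[OF f(1), of "\<lambda>x. \<not> (u < x \<and> x < v)"] by simp
      have "(u + v) / 2 \<in> {u<..<v} \<inter> closure {x. 0 < f x}"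
        unfolding supp using uv by auto
      then have "{u<..<v} \<inter> {x. 0 < f x} \<noteq> {}"
        using open_Int_closure_eq_empty[OF open_greaterThanLessThan, of u v "{x. 0 < f x}"] by (metis empty_iff)
      then obtain w where w: "0 < f w" "u < w" "w < v"
        by auto
      define S where "S = {u<..<v} \<inter> f -` {0<..}"
      have "open S"
        unfolding S_def using uv
        by (intro continuous_open_preimage continuous_on_subset[OF f(2)]) auto
      moreover have "AE x\<in>S in lebesgue. x \<in> {}"
        using AE_completion[OF ae] by eventually_elim (auto simp: S_def)
      ultimately have "w \<in> {}"
        using w by (intro mem_closed_if_AE_lebesgue_open[of S "{}" w]) (auto simp: S_def)
      then show False
        by simp
    qed
  qed simp
qed

theorem proposition6p6:
  fixes M :: "'w measure"
    and X :: "'w \<Rightarrow> real ^ 'n"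
    and a b :: "real ^ 'n"
    and f :: "'n \<Rightarrow> real \<Rightarrow> real"
    and y :: "real ^ 'n \<Rightarrow> real"
    and p :: "'n \<Rightarrow> nat"
    and \<Xi> :: "nat \<Rightarrow> 'n \<Rightarrow> real list"
  assumes "prob_space M"
    and "\<And>k. a $ k < b $ k"
    and "X \<in> measurable M (restrict_space borel (cbox a b))"
    and "prob_space.indep_vars M (\<lambda>_. borel) (\<lambda>k \<omega>. X \<omega> $ k) UNIV"
    and "\<And>k x. 0 \<le> f k x"
    and "\<And>k. distributed M lborel (\<lambda>\<omega>. X \<omega> $ k) (\<lambda>x. ennreal (f k x))"
    and "\<And>k. continuous_on {a $ k..b $ k} (f k)"
    and "\<And>k. closure {x. 0 < f k x} = {a $ k..b $ k}"
    and "y \<in> borel_measurable (restrict_space borel (cbox a b))"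
    and "integrable M (\<lambda>\<omega>. \<bar>y (X \<omega>)\<bar>\<^sup>2)"
    and "\<And>s k. open_knots (a $ k) (b $ k) (p k) (\<Xi> s k)"
    and "\<And>k. (\<lambda>s. mesh_size (\<Xi> s k)) \<longlonglongrightarrow> 0"
  shows "(\<lambda>s. LINT \<omega>|M. \<bar>y (X \<omega>) - sce M X p (\<Xi> s) y (X \<omega>)\<bar>\<^sup>2) \<longlonglongrightarrow> 0
    \<and> (\<forall>\<epsilon>>0. (\<lambda>s. measure M {\<omega> \<in> space M. \<bar>y (X \<omega>) - sce M X p (\<Xi> s) y (X \<omega>)\<bar> > \<epsilon>}) \<longlonglongrightarrow> 0)
    \<and> (\<forall>t. isCont (\<lambda>t. measure M {\<omega> \<in> space M. y (X \<omega>) \<le> t}) t \<longrightarrow>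
          (\<lambda>s. measure M {\<omega> \<in> space M. sce M X p (\<Xi> s) y (X \<omega>) \<le> t})
            \<longlonglongrightarrow> measure M {\<omega> \<in> space M. y (X \<omega>) \<le> t})
    \<and> (continuous_on UNIV (\<lambda>t. measure M {\<omega> \<in> space M. y (X \<omega>) \<le> t}) \<longrightarrow>
        uniform_limit UNIV
          (\<lambda>s t. measure M {\<omega> \<in> space M. sce M X p (\<Xi> s) y (X \<omega>) \<le> t})
          (\<lambda>t. measure M {\<omega> \<in> space M. y (X \<omega>) \<le> t}) sequentially)"
proof -
  interpret prob_space M by fact
  have X_cbox: "X \<omega> \<in> cbox a b" if "\<omega> \<in> space M" for \<omega>
    using measurable_space[OF assms(3) that] by (simp add: space_restrict_space)
  have X [measurable]: "X \<in> borel_measurable M"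
    using assms(3) by (simp add: measurable_restrict_space2_iff)
  have "spline_variable (a $ k) (b $ k) (p k) (\<Xi> s k) M (\<lambda>\<omega>. X \<omega> $ k)" for s k
    using assms(1,2,6-8,11) X_cbox
    by (intro spline_variable_of_density[where f = "f k"]) (auto simp: open_knot_sequence_def mem_box_cart)
  then have splines: "spline_vector M X a b p (\<Xi> s)" for s
    using assms(1,4) by (simp add: spline_vector_def spline_vector_axioms_def)
  \<comment> \<open>\<open>y\<close> is measurable on the box only. Extended by 0 it is a Borel function on the whole space, on
    which the law of \<open>X\<close> lives.\<close>
  define y0 where "y0 x = (if x \<in> cbox a b then y x else 0)" for x
  have "y0 = (\<lambda>x. indicator (cbox a b) x *\<^sub>R y x)"
    by (auto simp: y0_def indicator_def)
  then have [measurable]: "y0 \<in> borel_measurable borel"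
    using assms(9) by (simp add: borel_measurable_restrict_space_iff)
  have y0_X: "y0 (X \<omega>) = y (X \<omega>)" if "\<omega> \<in> space M" for \<omega>
    using X_cbox[OF that] by (simp add: y0_def)
  define N where "N = distr M borel X"
  interpret N: prob_space N
    unfolding N_def by (rule prob_space_distr) simp
  have pull: "square_integrable M (\<lambda>\<omega>. g (X \<omega>)) \<longleftrightarrow> square_integrable N g" if "g \<in> borel_measurable borel" for g
    using that by (auto simp: square_integrable_def N_def integrable_distr_eq)
  have y: "square_integrable M (\<lambda>\<omega>. y (X \<omega>))"
    using assms(3,9,10) by (auto simp: square_integrable_def intro: measurable_compose)
  have "square_integrable M (\<lambda>\<omega>. y0 (X \<omega>)) = square_integrable M (\<lambda>\<omega>. y (X \<omega>))"
    unfolding square_integrable_def using y0_X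
    by (intro arg_cong2[where f = "(\<and>)"] measurable_cong Bochner_Integration.integrable_cong) auto
  then have y0: "square_integrable N y0"
    using pull y by auto
  have dense: "L2_approximable N y0"
    using y0 by (intro continuous_functions_dense_in_L2) (auto simp: N_def N.finite_measure_axioms[unfolded N_def])
  let ?Y = "\<lambda>s \<omega>. sce M X p (\<Xi> s) y (X \<omega>)"
  have Y: "square_integrable M (?Y s)" for s
    by (rule spline_vector.square_integrable_sce[OF splines])
  have mean_square: "(\<lambda>s. \<integral>\<omega>. (y (X \<omega>) - ?Y s \<omega>)\<^sup>2 \<partial>M) \<longlonglongrightarrow> 0"
  proof (rule tendstoI)
    fix \<eta> :: real assume \<eta>: "\<eta> > 0"
    obtain g where g: "continuous_on UNIV g" "square_integrable N g" "(\<integral>x. (y0 x - g x)\<^sup>2 \<partial>N) < \<eta> / 4"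
      using dense \<eta> unfolding L2_approximable_def by (meson divide_pos_pos zero_less_numeral)
    have [measurable]: "g \<in> borel_measurable borel"
      using g(1) by (rule borel_measurable_continuous_onI)
    have g_M: "square_integrable M (\<lambda>\<omega>. g (X \<omega>))"
      using g(2) pull by auto
    have "(\<integral>x. (y0 x - g x)\<^sup>2 \<partial>N) = (\<integral>\<omega>. (y0 (X \<omega>) - g (X \<omega>))\<^sup>2 \<partial>M)"
      unfolding N_def by (rule integral_distr) auto
    also have "\<dots> = (\<integral>\<omega>. (y (X \<omega>) - g (X \<omega>))\<^sup>2 \<partial>M)"
      by (intro Bochner_Integration.integral_cong) (auto simp: y0_X)
    finally have near: "(\<integral>\<omega>. (y (X \<omega>) - g (X \<omega>))\<^sup>2 \<partial>M) < \<eta> / 4"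
      using g(3) by simp
    \<comment> \<open>The error bound is twice the mean-square distance to \<open>g\<close> plus \<open>2 * e\<^sup>2\<close>; with this \<open>e\<close> it is below
      \<open>\<eta> / 2 + \<eta> / 4\<close>.\<close>
    define e where "e = sqrt (\<eta> / 8)"
    have e: "e > 0" "2 * e\<^sup>2 = \<eta> / 4"
      using \<eta> by (auto simp: e_def)
    have uc: "uniformly_continuous_on (cbox a b) g"
      by (intro compact_uniformly_continuous continuous_on_subset[OF g(1)]) auto
    obtain \<delta> where \<delta>: "\<delta> > 0" "\<And>x z. x \<in> cbox a b \<Longrightarrow> z \<in> cbox a b \<Longrightarrow> dist z x < \<delta> \<Longrightarrow> dist (g z) (g x) < e"
      by (rule uniformly_continuous_onE[OF uc e(1)]) blast
    have "(\<lambda>s. \<Sum>k\<in>UNIV. real (p k + 1) * mesh_size (\<Xi> s k)) \<longlonglongrightarrow> (\<Sum>k\<in>UNIV. real (p k + 1) * 0)"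
      by (intro tendsto_intros assms(12))
    then have "eventually (\<lambda>s. (\<Sum>k\<in>UNIV. real (p k + 1) * mesh_size (\<Xi> s k)) < \<delta>) sequentially"
      using order_tendstoD(2)[of _ 0 sequentially \<delta>] \<delta>(1) by auto
    then show "eventually (\<lambda>s. dist (\<integral>\<omega>. (y (X \<omega>) - ?Y s \<omega>)\<^sup>2 \<partial>M) 0 < \<eta>) sequentially"
    proof eventually_elim
      case (elim s)
      have "(\<integral>\<omega>. (y (X \<omega>) - ?Y s \<omega>)\<^sup>2 \<partial>M) \<le> 2 * (\<integral>\<omega>. (y (X \<omega>) - g (X \<omega>))\<^sup>2 \<partial>M) + 2 * e\<^sup>2"
      proof (rule spline_vector.sce_error_bound[OF splines y g_M])
        fix x z assume xz: "x \<in> cbox a b" "z \<in> cbox a b"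
          and close: "\<And>k. \<bar>x $ k - z $ k\<bar> \<le> real (p k + 1) * mesh_size (\<Xi> s k)"
        have "dist x z \<le> (\<Sum>k\<in>UNIV. \<bar>x $ k - z $ k\<bar>)"
          using norm_le_l1_cart[of "x - z"] by (simp add: dist_norm)
        also have "\<dots> \<le> (\<Sum>k\<in>UNIV. real (p k + 1) * mesh_size (\<Xi> s k))"
          by (intro sum_mono close)
        finally show "\<bar>g x - g z\<bar> \<le> e"
          using \<delta>(2)[OF xz(2,1)] elim by (simp add: dist_real_def)
      qed
      also have "\<dots> < \<eta>"
        using near e(2) \<eta> by simp
      finally show ?case
        by simp
    qed
  qed
  have in_prob: "(\<lambda>s. prob {\<omega> \<in> space M. \<bar>y (X \<omega>) - ?Y s \<omega>\<bar> > \<epsilon>}) \<longlonglongrightarrow> 0" if "\<epsilon> > 0" for \<epsilon>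
    by (rule mean_square_imp_in_probability[OF y Y mean_square that])
  show ?thesis
    using mean_square in_prob
      in_probability_imp_in_distribution[OF square_integrableD(1)[OF y] square_integrableD(1)[OF Y] in_prob]
      in_probability_imp_uniform_distribution[OF square_integrableD(1)[OF y] square_integrableD(1)[OF Y] in_prob]
    by simp
qed

end
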